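(* Let $d\ge3$ and $s\in\mathbb{N}$ be integers, and let $x\in\mathbb{R}\setminus\mathbb{Q}$ be non-Liouville. Suppose that at least one of the following holds: (a) there exist $\varepsilon>0$ and $R\ge1$ such that $\dfrac{\log^{s-1}\Delta k_m}{\log^{s-1}k_m}\ge1+\varepsilon$ for infinitely many $m\in\mathbb{N}$; (b) the essential Diophantine type of $x$ is greater than $1$ and $\Delta k_m\le k_m$ for all sufficiently large $m$; precisely, there exist $R\ge1$ and $\sigma>1$ such that, for the sequence $\{k_m\}$ associated with $x$ and $R$, one has $q_{k_{m_j}}^{\sigma}<q_{k_{m_j}+1}$ along some sequence $\{m_j\}\subseteq\mathbb{N}$ of positive lower asymptotic density, and $\Delta k_m\le k_m$ for all sufficiently large $m$. Then $\mathcal{W}_d(\psi_{s,d})\cap(\{x\}\times\mathbb{R}^{d-1})$ has full $(d-1)$-dimensional Lebesgue measure in $\{x\}\times\mathbb{R}^{d-1}$; that is, for Lebesgue-almost every $(x_2,\dots,x_d)\in\mathbb{R}^{d-1}$ one has $(x,x_2,\dots,x_d)\in\mathcal{W}_d(\psi_{s,d})$.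
   Context: For $\psi:\mathbb{N}\to[0,\infty)$, $\mathcal{W}_d(\psi)$ is the set of $\boldsymbol{x}\in\mathbb{R}^d$ such that $\|q\boldsymbol{x}-\boldsymbol{p}\|_\infty<\psi(q)$ holds for infinitely many $(\boldsymbol{p},q)\in\mathbb{Z}^d\times\mathbb{N}$. Here $\log^{j}$ denotes the $j$-fold iterated logarithm ($\log^0$ is the identity), and $\psi_{s,d}(q)=\left(q\,(\log q)(\log^2 q)\cdots(\log^s q)\right)^{-1/d}$ for all $q$ large enough that all the iterated logarithms are defined and positive; the finitely many remaining values are irrelevant. A real $x$ is Liouville if for every $\tau>0$ the inequality $|qx-p|<q^{-\tau}$ holds for infinitely many $(p,q)\in\mathbb{Z}\times\mathbb{N}$. For irrational $x=[a_0;a_1,a_2,\dots]$ (simple continued fraction), the continuants are $q_{-1}=0$, $q_0=1$, $q_k=a_kq_{k-1}+q_{k-2}$. Given an integer $R\ge0$, put $k_0=-1$ and let $k_1<k_2<\cdots$ be the increasing list of all indices $k\ge0$ with $a_{k+1}>R$; put $\Delta k_m=k_{m+1}-k_m$. The essential Diophantine type of $x$ is the supremum of all $\sigma\in[1,\infty)$ for which there is $R\ge0$ such that $q_{k_{m_j}}^\sigma<q_{k_{m_j}+1}$ along some sequence $\{m_j\}\subseteq\mathbb{N}$ of positive lower asymptotic density. Condition (b) is understood to require the list $\{k_m\}$ to be infinite. *)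

theory Defs
  imports "HOL-Analysis.Analysis"
begin

text \<open>Points of \<open>\<real>\<^sup>d\<close> and \<open>\<int>\<^sup>d\<close> are functions on the index set \<open>{1..d}\<close>,
  extended by \<open>undefined\<close> outside it, so that distinct functions are distinct points;
  \<open>\<nat>\<close> denotes the positive integers.\<close>

definition sup_norm :: "nat \<Rightarrow> (nat \<Rightarrow> real) \<Rightarrow> real" where
  "sup_norm d v = Max ((\<lambda>i. \<bar>v i\<bar>) ` {1..d})"

definition W :: "nat \<Rightarrow> (nat \<Rightarrow> real) \<Rightarrow> (nat \<Rightarrow> real) set" where
  "W d \<psi> = {x \<in> {1..d} \<rightarrow>\<^sub>E (UNIV :: real set).
     infinite {(p, q). p \<in> {1..d} \<rightarrow>\<^sub>E (UNIV :: int set) \<and> q \<ge> 1 \<and>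
       sup_norm d (\<lambda>i. real q * x i - of_int (p i)) < \<psi> q}}"

abbreviation iter_ln :: "nat \<Rightarrow> real \<Rightarrow> real" where
  "iter_ln j x \<equiv> (ln ^^ j) x"

text \<open>Since \<open>ln\<close> is a total function, that the \<open>j\<close>-fold iterated logarithm of \<open>x\<close> makes
  sense has to be said explicitly: every logarithm is taken of a positive number.\<close>

definition iter_ln_defined :: "nat \<Rightarrow> real \<Rightarrow> bool" where
  "iter_ln_defined j x \<longleftrightarrow> (\<forall>i<j. 0 < iter_ln i x)"

text \<open>The finitely many values of \<open>q\<close> at which some iterated logarithm is undefined or not
  positive get the value \<open>0\<close>; changing them does not affect \<open>W d (\<psi> s d)\<close>.\<close>

definition \<psi> :: "nat \<Rightarrow> nat \<Rightarrow> nat \<Rightarrow> real" where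
  "\<psi> s d q =
     (if iter_ln_defined s (real q) \<and> 0 < iter_ln s (real q)
      then (real q * (\<Prod>j=1..s. iter_ln j (real q))) powr (- 1 / real d)
      else 0)"

definition Liouville :: "real \<Rightarrow> bool" where
  "Liouville x \<longleftrightarrow>
     (\<forall>\<tau>>0. infinite {(p :: int, q :: nat). q \<ge> 1 \<and>
        \<bar>real q * x - of_int p\<bar> < real q powr (- \<tau>)})"

text \<open>For irrational \<open>x\<close> no \<open>frac\<close> below vanishes, so \<open>x = [a\<^sub>0; a\<^sub>1, a\<^sub>2, \<dots>]\<close> with
  \<open>a\<^sub>n = partial_quotient x n\<close>.\<close>

fun complete_quotient :: "real \<Rightarrow> nat \<Rightarrow> real" where
  "complete_quotient x 0 = x"
| "complete_quotient x (Suc n) = 1 / frac (complete_quotient x n)"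

definition partial_quotient :: "real \<Rightarrow> nat \<Rightarrow> int" where
  "partial_quotient x n = \<lfloor>complete_quotient x n\<rfloor>"

text \<open>The continuants \<open>q\<^sub>k\<close> start at \<open>k = -1\<close>: \<open>shifted_continuant x n\<close> is \<open>q\<^sub>n\<^sub>-\<^sub>1\<close>.\<close>

fun shifted_continuant :: "real \<Rightarrow> nat \<Rightarrow> int" where
  "shifted_continuant x 0 = 0"
| "shifted_continuant x (Suc 0) = 1"
| "shifted_continuant x (Suc (Suc n)) =
     partial_quotient x (Suc n) * shifted_continuant x (Suc n) + shifted_continuant x n"

definition continuant :: "real \<Rightarrow> int \<Rightarrow> int" where
  "continuant x k = shifted_continuant x (nat (k + 1))"

definition large_indices :: "real \<Rightarrow> nat \<Rightarrow> nat set" where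
  "large_indices x R = {k. partial_quotient x (Suc k) > int R}"

text \<open>The list \<open>k\<^sub>0 = -1 < k\<^sub>1 < k\<^sub>2 < \<dots>\<close>, meaningful for all \<open>m\<close> only if
  \<open>large_indices x R\<close> is infinite.\<close>

definition kseq :: "real \<Rightarrow> nat \<Rightarrow> nat \<Rightarrow> int" where
  "kseq x R m = (if m = 0 then -1 else int (enumerate (large_indices x R) (m - 1)))"

definition \<Delta>k :: "real \<Rightarrow> nat \<Rightarrow> nat \<Rightarrow> int" where
  "\<Delta>k x R m = kseq x R (Suc m) - kseq x R m"

definition lower_density :: "nat set \<Rightarrow> ereal" where
  "lower_density M = liminf (\<lambda>n. ereal (real (card (M \<inter> {1..n})) / real n))"

definition condition_a :: "nat \<Rightarrow> real \<Rightarrow> bool" where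
  "condition_a s x \<longleftrightarrow>
     (\<exists>\<epsilon>>0. \<exists>R\<ge>1. infinite (large_indices x R) \<and>
        infinite {m. iter_ln_defined (s - 1) (of_int (\<Delta>k x R m)) \<and>
                     iter_ln_defined (s - 1) (of_int (kseq x R m)) \<and>
                     iter_ln (s - 1) (of_int (\<Delta>k x R m)) / iter_ln (s - 1) (of_int (kseq x R m))
                       \<ge> 1 + \<epsilon>})"

definition condition_b :: "real \<Rightarrow> bool" where
  "condition_b x \<longleftrightarrow>
     (\<exists>R\<ge>1. \<exists>\<sigma>>1. infinite (large_indices x R) \<and>
        (\<exists>M \<subseteq> {1..}. lower_density M > 0 \<and>
           (\<forall>m\<in>M. of_int (continuant x (kseq x R m)) powr \<sigma>
                    < (of_int (continuant x (kseq x R m + 1)) :: real))) \<and>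
        (\<forall>\<^sub>F m in sequentially. \<Delta>k x R m \<le> kseq x R m))"

end

theory Submission imports Defs begin

text \<open>Write \<open>\<parallel>t\<parallel>\<close> for the distance of \<open>t\<close> to the nearest integer. On the fiber over \<open>x\<close> only
  the \<open>q\<close> with \<open>\<parallel>q x\<parallel> < \<psi> q\<close> are available. By the pigeonhole principle these are numerous enough
  for \<open>\<Sum> \<psi> q ^ (d - 1)\<close> over them to diverge. Since \<open>d - 1 \<ge> 2\<close>, Gallagher's form of
  Khintchine's theorem, which needs no monotonicity, applies to \<open>\<psi>\<close> restricted to those \<open>q\<close>.
  It is proved by a second-moment argument for rational points with coprime numerators, whose
  neighbourhoods are pairwise quasi-independent, followed by a zero-one law: the set of points
  approximable up to an unspecified constant is periodic and mapped into itself by doubling.\<close>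

section \<open>Denominators available on the fiber\<close>

text \<open>On the fiber a denominator \<open>q\<close> is available with frequency at least of
  order \<open>\<psi> q\<close>, so the series of \<open>\<psi> q ^ (d - 1)\<close> over available
  \<open>q\<close> is compared with that of \<open>\<psi> q ^ d\<close>, the divergent series of
  \<open>1 / (q log q ... log^s q)\<close>. Counting loses an additive 1, which is harmless because
  \<open>q * \<psi> q\<close> tends to infinity. The obstacle to independence is that one rational
  point has many denominators: if neighbourhoods for \<open>q\<close> and \<open>r\<close> share
  centres, their overlap can far exceed the product of their measures. Coprime numerators make the
  denominator a function of the point. Centres for distinct denominators then differ in some
  coordinate by at least \<open>gcd q r / (q * r)\<close>, which is exactly the separation beyond
  which a count of close fractions gives an overlap of product order. Doubling a point also doubles
  its approximation error, so invariance is available only when the constant is left open. The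
  argument is therefore run for a slightly smaller function than the given one.\<close>

lemma card_small_multiples_ge:
  fixes x \<delta> :: real and N :: nat
  assumes "0 < \<delta>" "\<delta> \<le> 1"
  shows "real N * \<delta> / 2 - 1 \<le> real (card {q \<in> {1..N}. \<exists>p::int. \<bar>real q * x - of_int p\<bar> < \<delta>})"
    (is "_ \<le> real (card ?S)")
proof -
  \<comment> \<open>The \<open>N + 1\<close> fractional parts of \<open>q * x\<close>,
    \<open>q \<le> N\<close>, are sorted into \<open>K\<close> boxes of length
    \<open>1 / K \<le> \<delta>\<close>. The bound \<open>K * \<delta> \<le> 2\<close> is the origin
    of the factor \<open>1 / 2\<close> in the conclusion.\<close>
  define K where "K = nat \<lceil>1 / \<delta>\<rceil>"
  have "1 / \<delta> \<ge> 1" using assms by simp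
  then have K: "real K \<ge> 1 / \<delta>" "real K \<le> 1 / \<delta> + 1" "K > 0"
    unfolding K_def by linarith+
  have K\<delta>: "1 \<le> real K * \<delta>" "real K * \<delta> \<le> 2"
    using K assms by (auto simp: field_simps)
  define f where "f q = nat \<lfloor>frac (real q * x) * K\<rfloor>" for q :: nat
  have f: "f \<in> {..N} \<rightarrow> {..<K}"
  proof
    fix q
    have "frac (real q * x) * real K < 1 * real K"
      using K by (intro mult_strict_right_mono frac_lt_1) auto
    then show "f q \<in> {..<K}"
      using K by (simp add: f_def nat_less_iff floor_less_iff)
  qed
  have "{..<K} \<noteq> {}" using K by auto
  from pigeonhole_card[OF f _ _ this] obtain j where
    j: "card (f -` {j} \<inter> {..N}) * K \<ge> N + 1"
    by auto
  define B where "B = f -` {j} \<inter> {..N}"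
  have finB: "finite B" by (simp add: B_def)
  have Bne: "B \<noteq> {}" using j unfolding B_def[symmetric] by auto
  define m where "m = Min B"
  have mB: "m \<in> B" using finB Bne by (simp add: m_def)
  \<comment> \<open>Two members of one box have a difference whose multiple of \<open>x\<close> is
    close to an integer. Subtracting the least member \<open>m\<close> keeps the differences
    positive and distinct; \<open>m\<close> itself is the 1 that is lost.\<close>
  have "(\<lambda>q. q - m) ` (B - {m}) \<subseteq> ?S"
  proof safe
    fix q assume q: "q \<in> B" "q \<noteq> m"
    then have "m < q" using finB by (metis Min_le le_neq_implies_less m_def)
    then show "q - m \<in> {1..N}" using q by (auto simp: B_def)
    have "f q = f m" using q mB by (auto simp: B_def)
    moreover have "frac (real q * x) * K \<ge> 0" "frac (real m * x) * K \<ge> 0" by simp_all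
    ultimately have "\<lfloor>frac (real q * x) * K\<rfloor> = \<lfloor>frac (real m * x) * K\<rfloor>"
      unfolding f_def by (smt (verit) int_nat_eq zero_le_floor)
    then have "\<bar>frac (real q * x) * K - frac (real m * x) * K\<bar> < 1"
      by linarith
    then have "\<bar>frac (real q * x) - frac (real m * x)\<bar> * K < 1"
      by (simp add: abs_mult flip: left_diff_distrib)
    also note K\<delta>(1)
    finally have "\<bar>frac (real q * x) - frac (real m * x)\<bar> < \<delta>"
      using K by (simp add: mult.commute)
    then have "\<bar>real (q - m) * x - of_int (\<lfloor>real q * x\<rfloor> - \<lfloor>real m * x\<rfloor>)\<bar> < \<delta>"
      using \<open>m < q\<close> by (simp add: frac_def of_nat_diff algebra_simps)
    then show "\<exists>p::int. \<bar>real (q - m) * x - of_int p\<bar> < \<delta>" by blast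
  qed
  moreover have "inj_on (\<lambda>q. q - m) (B - {m})"
    using finB by (intro inj_on_diff_nat) (auto simp: m_def)
  ultimately have "card (B - {m}) \<le> card ?S"
    by (intro card_inj_on_le[of _ _ ?S]) auto
  then have "real (card B) - 1 \<le> real (card ?S)"
    using mB finB by simp
  moreover have "real N * \<delta> / 2 \<le> real (card B)"
  proof -
    have "real N + 1 \<le> real (card B) * real K"
      using j unfolding B_def[symmetric] by (metis of_nat_1 of_nat_add of_nat_le_iff of_nat_mult)
    then have "(real N + 1) * \<delta> \<le> real (card B) * real K * \<delta>"
      using assms by (intro mult_right_mono) auto
    also have "\<dots> \<le> real (card B) * 2"
      using K\<delta> by (simp add: mult.assoc mult_left_mono)
    finally show ?thesis using assms by (simp add: algebra_simps)
  qed
  ultimately show ?thesis by linarith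
qed

text \<open>By the pigeonhole principle the multiples of \<open>x\<close> within \<open>\<phi> N\<close> of an integer number at
  least \<open>N \<phi> N / 2 - 1\<close> up to \<open>N\<close>, whatever \<open>x\<close> is; Abel summation turns this
  into divergence of the thinned-out series.\<close>

lemma not_summable_restrict_near_integers:
  fixes \<phi> :: "nat \<Rightarrow> real" and x :: real and n q\<^sub>0 :: nat
  assumes pos: "\<And>q. q \<ge> q\<^sub>0 \<Longrightarrow> 0 < \<phi> q" "\<And>q. q \<ge> q\<^sub>0 \<Longrightarrow> \<phi> q \<le> 1"
    and dec: "\<And>q r. q\<^sub>0 \<le> q \<Longrightarrow> q \<le> r \<Longrightarrow> \<phi> r \<le> \<phi> q"
    and decay: "\<And>q. q \<ge> q\<^sub>0 \<Longrightarrow> \<phi> (Suc q) ^ n \<le> \<phi> q ^ n * (1 - 1 / (2 * (real q + 1)))"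
    and lim: "filterlim (\<lambda>q. real q * \<phi> q) at_top sequentially"
    and div: "\<not> summable (\<lambda>q. \<phi> q ^ Suc n)"
  shows "\<not> summable (\<lambda>q. if q \<ge> q\<^sub>0 \<and> (\<exists>p::int. \<bar>real q * x - of_int p\<bar> < \<phi> q) then \<phi> q ^ n else 0)"
proof
  define c where "c q = (if q \<ge> q\<^sub>0 \<and> (\<exists>p::int. \<bar>real q * x - of_int p\<bar> < \<phi> q) then 1 else 0 :: real)" for q
  define a where "a q = \<phi> q ^ n" for q
  define C where "C m = (\<Sum>q<m. c q)" for m
  assume "summable (\<lambda>q. if q \<ge> q\<^sub>0 \<and> (\<exists>p::int. \<bar>real q * x - of_int p\<bar> < \<phi> q) then \<phi> q ^ n else 0)"
  also have "(\<lambda>q. if q \<ge> q\<^sub>0 \<and> (\<exists>p::int. \<bar>real q * x - of_int p\<bar> < \<phi> q) then \<phi> q ^ n else 0) = (\<lambda>q. c q * a q)"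
    by (auto simp: c_def a_def fun_eq_iff)
  finally have sm: "summable (\<lambda>q. c q * a q)" .
  have ca0: "c q * a q \<ge> 0" for q
    using pos[of q] by (auto simp: c_def a_def)
  have c0: "c q \<ge> 0" for q by (simp add: c_def)
  have C0: "C m \<ge> 0" for m by (auto simp: C_def intro!: sum_nonneg c0)
  have Cz: "C m = 0" if "m \<le> q\<^sub>0" for m
    using that by (auto simp: C_def c_def intro!: sum.neutral)
  \<comment> \<open>\<open>C\<close> counts the available denominators below its argument. The
    boundary term \<open>C N * a N\<close> is nonnegative, so the partial sums on the left inherit
    the bound from the convergent series.\<close>
  have abel: "(\<Sum>q<N. C (Suc q) * (a q - a (Suc q))) + C N * a N = (\<Sum>q<N. c q * a q)" for N
    by (induction N) (simp_all add: C_def algebra_simps)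
  have drop: "a q / (2 * (real q + 1)) \<le> a q - a (Suc q)" if "q \<ge> q\<^sub>0" for q
    using decay[OF that] by (simp add: a_def algebra_simps)
  have a0: "a q > 0" if "q \<ge> q\<^sub>0" for q using pos(1)[OF that] by (simp add: a_def)
  have t0: "C (Suc q) * (a q - a (Suc q)) \<ge> 0" for q
  proof (cases "q \<ge> q\<^sub>0")
    case True
    have "0 \<le> a q / (2 * (real q + 1))" using a0[OF True] by simp
    with drop[OF True] C0 show ?thesis by (intro mult_nonneg_nonneg) auto
  qed (simp add: Cz)
  have Ca: "C N * a N \<ge> 0" for N
    using C0 a0[of N] Cz[of N] by (cases "N \<ge> q\<^sub>0") (auto simp: less_imp_le)
  have "summable (\<lambda>q. C (Suc q) * (a q - a (Suc q)))"
  proof (rule bounded_imp_summable[OF t0])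
    fix N
    have "(\<Sum>q\<le>N. C (Suc q) * (a q - a (Suc q))) \<le> (\<Sum>q<Suc N. c q * a q)"
      using abel[of "Suc N"] Ca[of "Suc N"] by (simp add: lessThan_Suc_atMost)
    also have "\<dots> \<le> (\<Sum>q. c q * a q)" by (rule sum_le_suminf[OF sm]) (auto simp: ca0)
    finally show "(\<Sum>q\<le>N. C (Suc q) * (a q - a (Suc q))) \<le> (\<Sum>q. c q * a q)" .
  qed
  then have "summable (\<lambda>q. 16 * (C (Suc q) * (a q - a (Suc q))))" by (rule summable_mult)
  \<comment> \<open>The 16 is 4 times 4: the count \<open>C (Suc q)\<close> is at least
    \<open>q * \<phi> q / 4\<close> and the drop \<open>a q - a (Suc q)\<close> at least
    \<open>a q / (4 * q)\<close>.\<close>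
  moreover have "eventually (\<lambda>q. norm (\<phi> q ^ Suc n) \<le> 16 * (C (Suc q) * (a q - a (Suc q)))) sequentially"
  proof -
    \<comment> \<open>With this threshold a quarter of \<open>q * \<phi> q\<close> covers both the 1
      lost to the pigeonhole and the at most \<open>q\<^sub>0\<close> denominators below
      \<open>q\<^sub>0\<close>.\<close>
    have "eventually (\<lambda>q. real q * \<phi> q \<ge> 4 * (1 + real q\<^sub>0)) sequentially"
      using lim by (simp add: filterlim_at_top)
    then show ?thesis using eventually_ge_at_top[of "max 1 q\<^sub>0"]
    proof eventually_elim
      case (elim q)
      then have q: "q \<ge> q\<^sub>0" "q \<ge> 1" by auto
      let ?S = "{k \<in> {1..q}. \<exists>p::int. \<bar>real k * x - of_int p\<bar> < \<phi> q}"
      have "real q * \<phi> q / 2 - 1 \<le> real (card ?S)"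
        by (rule card_small_multiples_ge) (use pos q in auto)
      moreover have "real (card ?S) \<le> real q\<^sub>0 + real (card (?S - {..<q\<^sub>0}))"
      proof -
        have "card ?S \<le> card (?S - {..<q\<^sub>0}) + card {..<q\<^sub>0}"
          by (rule order_trans[OF card_mono card_Un_le]) auto
        then show ?thesis by simp
      qed
      moreover have "real (card (?S - {..<q\<^sub>0})) \<le> C (Suc q)"
      proof -
        have "real (card (?S - {..<q\<^sub>0})) = (\<Sum>k\<in>?S - {..<q\<^sub>0}. 1)" by simp
        also have "\<dots> \<le> (\<Sum>k\<in>?S - {..<q\<^sub>0}. c k)"
        proof (rule sum_mono)
          fix k assume k: "k \<in> ?S - {..<q\<^sub>0}"
          then obtain p :: int where "\<bar>real k * x - of_int p\<bar> < \<phi> q" by auto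
          \<comment> \<open>The count was made with the fixed radius \<open>\<phi> q\<close>; an
            earlier \<open>k\<close> is allowed the larger radius \<open>\<phi> k\<close>.\<close>
          also have "\<phi> q \<le> \<phi> k" using k by (intro dec) auto
          finally show "1 \<le> c k" using k by (auto simp: c_def)
        qed
        also have "\<dots> \<le> C (Suc q)"
          unfolding C_def by (intro sum_mono2) (auto simp: c0)
        finally show ?thesis .
      qed
      ultimately have "real q * \<phi> q / 4 \<le> C (Suc q)" using elim(1) by argo
      moreover have "a q / (4 * real q) \<le> a q - a (Suc q)"
      proof -
        have "a q / (4 * real q) \<le> a q / (2 * (real q + 1))"
          using a0[OF q(1)] q(2) by (intro divide_left_mono) auto
        with drop[OF q(1)] show ?thesis by linarith
      qed
      ultimately have "(real q * \<phi> q / 4) * (a q / (4 * real q)) \<le> C (Suc q) * (a q - a (Suc q))"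
        using a0[OF q(1)] C0 by (intro mult_mono) auto
      then show ?case using q pos(1)[OF q(1)] by (simp add: a_def field_simps)
    qed
  qed
  ultimately have "summable (\<lambda>q. \<phi> q ^ Suc n)"
    by (rule summable_comparison_test_ev[rotated])
  with div show False by contradiction
qed

section \<open>Iterated logarithms and the size of \<psi>\<close>

lemma filterlim_iter_ln: "filterlim (iter_ln j) at_top at_top"
proof (induction j)
  case 0 show ?case by (simp add: filterlim_ident id_def)
next
  case (Suc j)
  show ?case using filterlim_compose[OF ln_at_top Suc] by (simp add: o_def)
qed

lemma eventually_iter_ln_ge:
  "eventually (\<lambda>q::nat. \<forall>r\<ge>q. \<forall>j\<le>s. iter_ln j (real r) \<ge> c) sequentially"
proof -
  have "eventually (\<lambda>q::nat. \<forall>j\<in>{..s}. iter_ln j (real q) \<ge> c) sequentially"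
  proof (rule eventually_ball_finite)
    show "\<forall>j\<in>{..s}. eventually (\<lambda>q::nat. iter_ln j (real q) \<ge> c) sequentially"
      using filterlim_compose[OF filterlim_iter_ln filterlim_real_sequentially]
      by (auto simp: filterlim_at_top)
  qed simp
  from this[THEN eventually_all_ge_at_top] show ?thesis by (simp add: atMost_iff Ball_def)
qed

text \<open>The derivative of \<open>iter_ln j\<close> is
  \<open>1 / (\<Prod>i<j. iter_ln i x)\<close>, which decreases while the factors are positive, so
  an increment is at most the length times the derivative at the left end. Inductively this needs
  only \<open>ln v - ln u \<le> (v - u) / u\<close>.\<close>

lemma iter_ln_diff:
  assumes "x \<le> y" "\<And>i. i < j \<Longrightarrow> 0 < iter_ln i x"
  shows "iter_ln j x \<le> iter_ln j y" "iter_ln j y - iter_ln j x \<le> (y - x) / (\<Prod>i<j. iter_ln i x)"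
proof -
  have "iter_ln j x \<le> iter_ln j y \<and> iter_ln j y - iter_ln j x \<le> (y - x) / (\<Prod>i<j. iter_ln i x)"
    using assms(2)
  proof (induction j)
    case 0 then show ?case using assms(1) by simp
  next
    case (Suc j)
    define u v where "u = iter_ln j x" and "v = iter_ln j y"
    have IH: "u \<le> v" "v - u \<le> (y - x) / (\<Prod>i<j. iter_ln i x)"
      using Suc by (auto simp: u_def v_def)
    have u: "u > 0" using Suc.prems[of j] by (simp add: u_def)
    have "ln v - ln u \<le> (v - u) / u"
      using ln_diff_le[of v u] u IH by simp
    also have "\<dots> \<le> (y - x) / (\<Prod>i<j. iter_ln i x) / u"
      using u IH by (intro divide_right_mono) auto
    finally show ?case using u IH by (simp add: u_def v_def)
  qed
  then show "iter_ln j x \<le> iter_ln j y" "iter_ln j y - iter_ln j x \<le> (y - x) / (\<Prod>i<j. iter_ln i x)"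
    by auto
qed

text \<open>Each term dominates the increment of \<open>iter_ln (Suc s)\<close> from
  \<open>q\<close> to \<open>q + 1\<close>. Convergence would, by telescoping, bound a function that
  tends to infinity.\<close>

lemma not_summable_iter_ln: "\<not> summable (\<lambda>q. 1 / (\<Prod>i\<le>s. iter_ln i (real q)))"
proof
  obtain Q :: nat where Q: "\<And>q j. q \<ge> Q \<Longrightarrow> j \<le> s \<Longrightarrow> iter_ln j (real q) \<ge> 1"
    using eventually_iter_ln_ge[of s 1] by (auto simp: eventually_sequentially)
  assume "summable (\<lambda>q. 1 / (\<Prod>i\<le>s. iter_ln i (real q)))"
  then have sm: "summable (\<lambda>q. 1 / (\<Prod>i\<le>s. iter_ln i (real (q + Q))))"
    by (rule summable_ignore_initial_segment)
  define S where "S = (\<Sum>q. 1 / (\<Prod>i\<le>s. iter_ln i (real (q + Q))))"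
  have "iter_ln (Suc s) (real (N + Q)) \<le> S + iter_ln (Suc s) (real Q)" for N
  proof -
    have "iter_ln (Suc s) (real (N + Q)) - iter_ln (Suc s) (real Q)
        = (\<Sum>q<N. iter_ln (Suc s) (real (Suc q + Q)) - iter_ln (Suc s) (real (q + Q)))"
      by (subst sum_lessThan_telescope) simp
    also have "\<dots> \<le> (\<Sum>q<N. 1 / (\<Prod>i\<le>s. iter_ln i (real (q + Q))))"
    proof (rule sum_mono)
      fix q
      have "0 < iter_ln i (real (q + Q))" if "i < Suc s" for i
        using Q[of "q + Q" i] that by simp
      from iter_ln_diff(2)[where j = "Suc s", OF _ this, of "real (Suc q + Q)"]
      show "iter_ln (Suc s) (real (Suc q + Q)) - iter_ln (Suc s) (real (q + Q))
         \<le> 1 / (\<Prod>i\<le>s. iter_ln i (real (q + Q)))"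
        by (simp add: lessThan_Suc_atMost del: funpow.simps)
    qed
    also have "\<dots> \<le> S" unfolding S_def
      by (rule sum_le_suminf[OF sm]) (auto intro!: prod_nonneg order_trans[OF zero_le_one Q] simp del: of_nat_add)
    finally show ?thesis by simp
  qed
  moreover have "eventually (\<lambda>q::nat. iter_ln (Suc s) (real q) > S + iter_ln (Suc s) (real Q)) sequentially"
    using filterlim_compose[OF filterlim_iter_ln filterlim_real_sequentially]
    unfolding filterlim_at_top_dense by blast
  then obtain N where "\<And>q. q \<ge> N \<Longrightarrow> iter_ln (Suc s) (real q) > S + iter_ln (Suc s) (real Q)"
    by (auto simp: eventually_sequentially)
  from this[of "N + Q"] have "iter_ln (Suc s) (real (N + Q)) > S + iter_ln (Suc s) (real Q)" by simp
  ultimately show False by (meson not_le)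
qed

lemma \<psi>_eq:
  assumes "\<And>j. j \<le> s \<Longrightarrow> iter_ln j (real q) \<ge> 1"
  shows "\<psi> s d q = (\<Prod>j\<le>s. iter_ln j (real q)) powr (- 1 / real d)"
proof -
  have "0 < iter_ln j (real q)" if "j \<le> s" for j using assms[OF that] by linarith
  moreover have "(\<Prod>j\<le>s. iter_ln j (real q)) = real q * (\<Prod>j=1..s. iter_ln j (real q))"
    by (simp add: atMost_atLeast0 prod.atLeast_Suc_atMost del: funpow.simps)
  ultimately show ?thesis by (simp add: \<psi>_def iter_ln_defined_def)
qed

text \<open>All logarithmic factors together cost at most \<open>K * q powr (1 / 2)\<close>, so the
  product of iterated logarithms is at most \<open>K * q powr (3 / 2)\<close>. Since
  \<open>d \<ge> 2\<close>, its \<open>d\<close>-th root leaves at least a power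
  \<open>1 / 4\<close> of \<open>q\<close>.\<close>

lemma filterlim_times_\<psi>:
  assumes "d \<ge> 2"
  shows "filterlim (\<lambda>q. real q * \<psi> s d q) at_top sequentially"
proof -
  \<comment> \<open>Each of the \<open>s\<close> logarithms is bounded by
    \<open>q powr \<alpha> / \<alpha>\<close>; this choice keeps the total exponent
    \<open>s * \<alpha>\<close> below \<open>1 / 2\<close>, also for \<open>s = 0\<close>.\<close>
  define \<alpha> where "\<alpha> = 1 / (2 * (real s + 1))"
  have \<alpha>: "\<alpha> > 0" "real s * \<alpha> \<le> 1 / 2" by (simp_all add: \<alpha>_def field_simps)
  define K where "K = (1 / \<alpha>) ^ s"
  have K: "K > 0" using \<alpha> by (simp add: K_def)
  have "filterlim (\<lambda>q::nat. K powr (- 1 / real d) * real q powr (1 / 4)) at_top sequentially"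
  proof (rule filterlim_tendsto_pos_mult_at_top)
    show "((\<lambda>q::nat. K powr (- 1 / real d)) \<longlongrightarrow> K powr (- 1 / real d)) sequentially" by simp
    have "filterlim (\<lambda>q::nat. sqrt (sqrt (real q))) at_top sequentially"
      by (intro filterlim_compose[OF sqrt_at_top] filterlim_real_sequentially)
    also have "(\<lambda>q::nat. sqrt (sqrt (real q))) = (\<lambda>q. real q powr (1 / 4))"
      by (simp add: powr_powr flip: powr_half_sqrt)
    finally show "filterlim (\<lambda>q::nat. real q powr (1 / 4)) at_top sequentially" .
  qed (use K in auto)
  moreover have "eventually (\<lambda>q. K powr (- 1 / real d) * real q powr (1 / 4) \<le> real q * \<psi> s d q) sequentially"
    using eventually_iter_ln_ge[of s 1] eventually_ge_at_top[of 1]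
  proof eventually_elim
    case (elim q)
    then have L1: "iter_ln j (real q) \<ge> 1" if "j \<le> s" for j using that by blast
    have q: "real q \<ge> 1" using elim by simp
    have Lj: "iter_ln (Suc j) (real q) \<le> ln (real q)" if "Suc j \<le> s" for j
      using that
    proof (induction j)
      case (Suc j)
      then have "0 < iter_ln (Suc j) (real q)" using L1[of "Suc j"] by linarith
      from ln_less_self[OF this] Suc show ?case by simp
    qed simp
    have "(\<Prod>j\<le>s. iter_ln j (real q)) = real q * (\<Prod>j<s. iter_ln (Suc j) (real q))"
      by (simp add: prod.atMost_shift del: funpow.simps)
    also have "(\<Prod>j<s. iter_ln (Suc j) (real q)) \<le> (\<Prod>j<s. real q powr \<alpha> / \<alpha>)"
    proof (intro prod_mono conjI)
      fix j assume "j \<in> {..<s}"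
      then have j: "Suc j \<le> s" by simp
      show "0 \<le> iter_ln (Suc j) (real q)" using L1[OF j] by linarith
      show "iter_ln (Suc j) (real q) \<le> real q powr \<alpha> / \<alpha>"
        using Lj[OF j] ln_powr_bound[OF q \<alpha>(1)] by linarith
    qed
    also have "(\<Prod>j<s. real q powr \<alpha> / \<alpha>) = K * real q powr (real s * \<alpha>)"
      using q by (simp add: K_def power_divide powr_power)
    also have "\<dots> \<le> K * real q powr (1 / 2)"
      using K \<alpha> q by (intro mult_left_mono powr_mono) auto
    also have "real q * (K * real q powr (1 / 2)) = K * real q powr (3 / 2)"
      using q powr_mult_base[of "real q" "1/2"] by (simp add: ac_simps)
    finally have *: "(\<Prod>j\<le>s. iter_ln j (real q)) \<le> K * real q powr (3 / 2)"
      using q by (simp add: mult_left_mono)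
    have P: "1 \<le> (\<Prod>j\<le>s. iter_ln j (real q))" by (intro prod_ge_1) (auto intro: L1)
    have "K powr (- 1 / real d) * real q powr (1 / 4)
        \<le> K powr (- 1 / real d) * real q powr (1 + - 3 / 2 / real d)"
      using assms q K by (intro mult_left_mono powr_mono) (auto simp: field_simps)
    also have "\<dots> = real q * (K * real q powr (3 / 2)) powr (- 1 / real d)"
      using q K powr_add[of "real q" 1 "- 3 / 2 / real d"] by (simp add: powr_mult powr_powr)
    also have "\<dots> \<le> real q * (\<Prod>j\<le>s. iter_ln j (real q)) powr (- 1 / real d)"
      using P * by (intro mult_left_mono powr_mono2') auto
    finally show ?case by (simp add: \<psi>_eq L1)
  qed
  ultimately show ?thesis by (rule filterlim_at_top_mono)
qed

text \<open>This is the Abel summation argument with \<open>n = d - 1\<close>, for which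
  \<open>\<psi> ^ Suc n\<close> is the inverse product of iterated logarithms. The decay condition
  comes from the factor \<open>q\<close> of that product, which alone makes it grow by
  \<open>(q + 1) / q\<close> at each step.\<close>

lemma not_summable_\<psi>_near_integers:
  assumes d: "d \<ge> 2"
  shows "\<not> summable (\<lambda>q. if \<exists>p::int. \<bar>real q * x - of_int p\<bar> < \<psi> s d q then \<psi> s d q ^ (d - 1) else 0)"
proof -
  obtain Q :: nat where Q: "\<And>q j. q \<ge> Q \<Longrightarrow> j \<le> s \<Longrightarrow> iter_ln j (real q) \<ge> 1"
    using eventually_iter_ln_ge[of s 1] by (auto simp: eventually_sequentially)
  define P where "P q = (\<Prod>j\<le>s. iter_ln j (real q))" for q
  have \<psi>: "\<psi> s d q = P q powr (- 1 / real d)" if "q \<ge> Q" for q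
    unfolding P_def by (rule \<psi>_eq) (use Q that in auto)
  have P1: "P q \<ge> 1" if "q \<ge> Q" for q
    unfolding P_def by (intro prod_ge_1) (use Q that in auto)
  have mono: "iter_ln j (real q) \<le> iter_ln j (real r)" if "Q \<le> q" "q \<le> r" "j \<le> s" for q r j
  proof (rule iter_ln_diff(1))
    show "0 < iter_ln i (real q)" if "i < j" for i
      using Q[OF \<open>Q \<le> q\<close>, of i] that \<open>j \<le> s\<close> by simp
  qed (use that in simp)
  have Pmono: "P q \<le> P r" if "Q \<le> q" "q \<le> r" for q r
    unfolding P_def
  proof (intro prod_mono conjI mono that)
    show "0 \<le> iter_ln j (real q)" if "j \<in> {..s}" for j
      using Q[OF \<open>Q \<le> q\<close>, of j] that by simp
  qed auto
  have Pgrow: "P q * (real q + 1) / real q \<le> P (Suc q)" if "q \<ge> Q" for q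
  proof -
    have Pr: "P q = real q * (\<Prod>j<s. iter_ln (Suc j) (real q))" for q
      unfolding P_def by (simp add: prod.atMost_shift del: funpow.simps)
    have "q > 0" using Q[OF that, of 0] by simp
    then have "P q * (real q + 1) / real q = (real q + 1) * (\<Prod>j<s. iter_ln (Suc j) (real q))"
      by (simp add: Pr)
    also have "\<dots> \<le> (real q + 1) * (\<Prod>j<s. iter_ln (Suc j) (real (Suc q)))"
    proof (intro mult_left_mono prod_mono conjI)
      show "0 \<le> iter_ln (Suc j) (real q)" if "j \<in> {..<s}" for j
        using Q[OF \<open>q \<ge> Q\<close>, of "Suc j"] that by (simp del: funpow.simps)
      show "iter_ln (Suc j) (real q) \<le> iter_ln (Suc j) (real (Suc q))" if "j \<in> {..<s}" for j
        by (rule mono) (use that \<open>q \<ge> Q\<close> in auto)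
    qed auto
    finally show ?thesis by (simp add: Pr add.commute)
  qed
  have "\<not> summable (\<lambda>q. if q \<ge> Q \<and> (\<exists>p::int. \<bar>real q * x - of_int p\<bar> < \<psi> s d q)
      then \<psi> s d q ^ (d - 1) else 0)"
  proof (rule not_summable_restrict_near_integers)
    fix q assume q: "q \<ge> Q"
    show "0 < \<psi> s d q" using P1[OF q] by (simp add: \<psi>[OF q])
    have "P q powr (- 1 / real d) \<le> P q powr 0"
      using P1[OF q] by (intro powr_mono) auto
    then show "\<psi> s d q \<le> 1" using P1[OF q] by (simp add: \<psi>[OF q])
    show "\<psi> s d r \<le> \<psi> s d q" if "q \<le> r" for r
      using Pmono[OF q that] P1[OF q] q that by (auto simp: \<psi> intro!: powr_mono2')
    have q0: "real q > 0" using Q[OF q, of 0] by simp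
    define u where "u = real q / (real q + 1)"
    have u: "0 < u" "u \<le> 1" using q0 by (simp_all add: u_def)
    have pw: "\<psi> s d r ^ (d - 1) = P r powr (- (real (d - 1) / real d))" if "r \<ge> Q" for r
      using P1[OF that] by (simp add: \<psi>[OF that] powr_power)
    have "\<psi> s d (Suc q) ^ (d - 1) = P (Suc q) powr (- (real (d - 1) / real d))"
      using q by (intro pw) simp
    also have "\<dots> \<le> (P q / u) powr (- (real (d - 1) / real d))"
      using Pgrow[OF q] P1[OF q] u q0 by (intro powr_mono2') (auto simp: u_def divide_simps)
    also have "\<dots> = P q powr (- (real (d - 1) / real d)) * u powr (real (d - 1) / real d)"
      using P1[OF q] u by (simp add: powr_divide powr_minus divide_simps)
    \<comment> \<open>As \<open>u \<le> 1\<close> and \<open>d \<ge> 2\<close>, the exponent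
      \<open>(d - 1) / d\<close> may be lowered to \<open>1 / 2\<close>; the arithmetic-geometric
      mean inequality for 1 and \<open>u\<close> then makes the factor rational in
      \<open>q\<close>.\<close>
    also have "\<dots> \<le> P q powr (- (real (d - 1) / real d)) * u powr (1 / 2)"
      using u d by (intro mult_left_mono powr_mono') (auto simp: field_simps of_nat_diff)
    also have "\<dots> \<le> P q powr (- (real (d - 1) / real d)) * ((1 + u) / 2)"
      using u arith_geo_mean_sqrt[of 1 u] by (intro mult_left_mono) (auto simp: powr_half_sqrt)
    also have "(1 + u) / 2 = 1 - 1 / (2 * (real q + 1))"
      using q0 by (simp add: u_def field_simps)
    finally show "\<psi> s d (Suc q) ^ (d - 1) \<le> \<psi> s d q ^ (d - 1) * (1 - 1 / (2 * (real q + 1)))"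
      using pw[OF q] by simp
  next
    show "filterlim (\<lambda>q. real q * \<psi> s d q) at_top sequentially"
      using d by (rule filterlim_times_\<psi>)
    have "eventually (\<lambda>q. \<psi> s d q ^ Suc (d - 1) = 1 / P q) sequentially"
      using eventually_ge_at_top[of Q]
    proof eventually_elim
      case (elim q)
      then show ?case using d P1[OF elim]
        by (simp add: \<psi> powr_power powr_minus divide_simps del: power_Suc)
    qed
    then show "\<not> summable (\<lambda>q. \<psi> s d q ^ Suc (d - 1))"
      using not_summable_iter_ln[of s] unfolding P_def by (subst summable_cong)
  qed
  moreover have "eventually (\<lambda>q. (if q \<ge> Q \<and> (\<exists>p::int. \<bar>real q * x - of_int p\<bar> < \<psi> s d q)
      then \<psi> s d q ^ (d - 1) else 0) = (if \<exists>p::int. \<bar>real q * x - of_int p\<bar> < \<psi> s d q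
      then \<psi> s d q ^ (d - 1) else 0)) sequentially"
    using eventually_ge_at_top[of Q] by eventually_elim auto
  ultimately show ?thesis by (subst (asm) summable_cong)
qed

text \<open>The two functions differ by the factor \<open>iter_ln (Suc s) q powr (- 1 / d)\<close>,
  which tends to 0.\<close>

lemma eventually_times_\<psi>_Suc_le:
  assumes "d \<ge> 1"
  shows "eventually (\<lambda>q. c * \<psi> (Suc s) d q \<le> \<psi> s d q) sequentially"
proof -
  define c' where "c' = max c 1"
  have "eventually (\<lambda>q::nat. iter_ln (Suc s) (real q) \<ge> c' ^ d) sequentially"
    using filterlim_compose[OF filterlim_iter_ln filterlim_real_sequentially]
    unfolding filterlim_at_top by blast
  then show ?thesis using eventually_iter_ln_ge[of "Suc s" 1]
  proof eventually_elim
    case (elim q)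
    then have L1: "iter_ln j (real q) \<ge> 1" if "j \<le> Suc s" for j using that by blast
    have P: "1 \<le> (\<Prod>j\<le>s. iter_ln j (real q))" by (intro prod_ge_1) (auto intro: L1)
    have "c' = (c' ^ d) powr (1 / real d)"
      using assms by (simp add: c'_def powr_powr flip: powr_realpow)
    also have "\<dots> \<le> iter_ln (Suc s) (real q) powr (1 / real d)"
      using elim(1) by (intro powr_mono2) (auto simp: c'_def)
    finally have c': "c' \<le> iter_ln (Suc s) (real q) powr (1 / real d)" .
    have nz: "iter_ln (Suc s) (real q) > 0" using L1[of "Suc s"] by linarith
    have eq: "\<psi> (Suc s) d q = \<psi> s d q * iter_ln (Suc s) (real q) powr (- 1 / real d)"
      using P nz L1 by (simp add: \<psi>_eq powr_mult del: funpow.simps)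
    have \<psi>0: "\<psi> s d q \<ge> 0" by (simp add: \<psi>_eq L1)
    have "c * \<psi> (Suc s) d q \<le> c' * \<psi> (Suc s) d q"
      using \<psi>0 by (intro mult_right_mono) (auto simp: c'_def eq)
    also have "\<dots> \<le> iter_ln (Suc s) (real q) powr (1 / real d) * \<psi> (Suc s) d q"
      using c' \<psi>0 by (intro mult_right_mono) (auto simp: eq)
    also have "\<dots> = \<psi> s d q"
      using nz by (simp add: eq powr_minus field_simps del: funpow.simps)
    finally show ?case .
  qed
qed

section \<open>Quasi-independence and a zero-one law\<close>

text \<open>This is the second-moment (Chung-Erdos) bound. In place of the Cauchy-Schwarz
  inequality, \<open>(1 - t * S)\<^sup>2 \<ge> 0\<close> gives the pointwise estimate
  \<open>2 * t * S - t\<^sup>2 * S\<^sup>2 \<le> 1\<close> on the union, while \<open>S = 0\<close>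
  off it.\<close>

lemma measure_UN_ge_of_quasi_independent:
  fixes E :: "'b \<Rightarrow> 'a set" and C :: real
  assumes J: "finite J" and E: "\<And>q. q \<in> J \<Longrightarrow> E q \<in> fmeasurable M"
    and C: "C \<ge> 0"
    and indep: "\<And>q r. q \<in> J \<Longrightarrow> r \<in> J \<Longrightarrow> q \<noteq> r \<Longrightarrow>
      measure M (E q \<inter> E r) \<le> C * measure M (E q) * measure M (E r)"
    and large: "(\<Sum>q\<in>J. measure M (E q)) \<ge> 1"
  shows "1 / (C + 1) \<le> measure M (\<Union>q\<in>J. E q)"
proof -
  define \<sigma> where "\<sigma> = (\<Sum>q\<in>J. measure M (E q))"
  define S where "S y = (\<Sum>q\<in>J. indicat_real (E q) y)" for y
  \<comment> \<open>This value maximises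
    \<open>2 * t * \<sigma> - t\<^sup>2 * (C + 1) * \<sigma>\<^sup>2\<close>, where
    \<open>(C + 1) * \<sigma>\<^sup>2\<close> bounds the second moment.\<close>
  define t where "t = 1 / ((C + 1) * \<sigma>)"
  have \<sigma>: "\<sigma> \<ge> 1" using large by (simp add: \<sigma>_def)
  have int1: "integrable M (indicat_real (E q))" if "q \<in> J" for q
    using E[OF that] by (simp add: fmeasurable_def)
  have int2: "integrable M (indicat_real (E q \<inter> E r))" if "q \<in> J" "r \<in> J" for q r
    using fmeasurable.Int[OF E E, OF that] by (simp add: fmeasurable_def)
  have UN: "(\<Union>q\<in>J. E q) \<in> fmeasurable M"
    using J E by (intro fmeasurable.finite_UN) auto
  have S2: "(S y)\<^sup>2 = (\<Sum>q\<in>J. \<Sum>r\<in>J. indicat_real (E q \<inter> E r) y)" for y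
    by (simp add: S_def power2_eq_square sum_product indicator_inter_arith)
  have intS: "integrable M S" unfolding S_def using int1 by auto
  have intS2: "integrable M (\<lambda>y. (S y)\<^sup>2)" unfolding S2 using int2 by auto
  have "(\<integral>y. 2 * t * S y - t\<^sup>2 * (S y)\<^sup>2 \<partial>M) \<le> (\<integral>y. indicat_real (\<Union>q\<in>J. E q) y \<partial>M)"
  proof (rule integral_mono)
    show "integrable M (\<lambda>y. 2 * t * S y - t\<^sup>2 * (S y)\<^sup>2)" using intS intS2 by auto
    show "integrable M (indicat_real (\<Union>q\<in>J. E q))"
      using UN by (simp add: fmeasurable_def)
    show "2 * t * S y - t\<^sup>2 * (S y)\<^sup>2 \<le> indicat_real (\<Union>q\<in>J. E q) y" for y
    proof (cases "y \<in> (\<Union>q\<in>J. E q)")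
      case True
      have "0 \<le> (1 - t * S y)\<^sup>2" by simp
      then show ?thesis using True by (simp add: power2_eq_square algebra_simps)
    next
      case False
      then have "S y = 0" by (auto simp: S_def intro!: sum.neutral)
      then show ?thesis by simp
    qed
  qed
  also have "(\<integral>y. indicat_real (\<Union>q\<in>J. E q) y \<partial>M) = measure M (\<Union>q\<in>J. E q)"
    using UN by (simp add: fmeasurableD)
  also have "(\<integral>y. 2 * t * S y - t\<^sup>2 * (S y)\<^sup>2 \<partial>M) = 2 * t * \<sigma> - t\<^sup>2 * (\<integral>y. (S y)\<^sup>2 \<partial>M)"
  proof -
    have "(\<integral>y. S y \<partial>M) = \<sigma>"
      unfolding S_def \<sigma>_def using int1 E by (simp add: fmeasurableD)
    then show ?thesis using intS intS2 by simp
  qed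
  finally have 1: "2 * t * \<sigma> - t\<^sup>2 * (\<integral>y. (S y)\<^sup>2 \<partial>M) \<le> measure M (\<Union>q\<in>J. E q)" .
  have "(\<integral>y. (S y)\<^sup>2 \<partial>M) = (\<Sum>q\<in>J. \<Sum>r\<in>J. measure M (E q \<inter> E r))"
    unfolding S2 using int2 E
    by (subst Bochner_Integration.integral_sum, force)
       (intro sum.cong refl, subst Bochner_Integration.integral_sum, auto simp: fmeasurableD sets.Int)
  \<comment> \<open>Quasi-independence covers only \<open>q \<noteq> r\<close>. The diagonal adds
    \<open>\<sigma>\<close>, which \<open>\<sigma> \<ge> 1\<close> absorbs into
    \<open>\<sigma>\<^sup>2\<close>.\<close>
  also have "\<dots> \<le> (\<Sum>q\<in>J. \<Sum>r\<in>J. C * measure M (E q) * measure M (E r) + (if r = q then measure M (E q) else 0))"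
    using indep C by (intro sum_mono) (auto intro: mult_nonneg_nonneg)
  also have "\<dots> = C * \<sigma> * \<sigma> + \<sigma>"
    using J by (simp add: sum.distrib \<sigma>_def flip: sum_distrib_left sum_distrib_right)
  also have "\<dots> \<le> (C + 1) * \<sigma>\<^sup>2"
    using \<sigma> mult_left_mono[of 1 \<sigma> \<sigma>] by (simp add: power2_eq_square algebra_simps)
  finally have "t\<^sup>2 * (\<integral>y. (S y)\<^sup>2 \<partial>M) \<le> t\<^sup>2 * ((C + 1) * \<sigma>\<^sup>2)"
    by (intro mult_left_mono) auto
  also have "\<dots> = 1 / (C + 1)"
    using \<sigma> C by (simp add: t_def power2_eq_square divide_simps)
  finally have "t\<^sup>2 * (\<integral>y. (S y)\<^sup>2 \<partial>M) \<le> 1 / (C + 1)" .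
  moreover have "2 * t * \<sigma> = 2 / (C + 1)"
    using \<sigma> C by (simp add: t_def divide_simps)
  ultimately show ?thesis using 1 by (simp add: field_simps)
qed

text \<open>Divergence lets every tail contain a finite block of total measure at least 1, so every
  tail union has measure at least \<open>1 / (C + 1)\<close>. The unions decrease inside
  \<open>U\<close>, of finite measure, and continuity from above passes the bound to the limit
  superior.\<close>

lemma emeasure_limsup_pos_of_quasi_independent:
  fixes E :: "nat \<Rightarrow> 'a set" and C :: real
  assumes U: "U \<in> fmeasurable M" and E: "\<And>q. E q \<in> sets M" "\<And>q. E q \<subseteq> U"
    and C: "C \<ge> 0"
    and indep: "\<And>q r. q \<noteq> r \<Longrightarrow> measure M (E q \<inter> E r) \<le> C * measure M (E q) * measure M (E r)"
    and div: "\<not> summable (\<lambda>q. measure M (E q))"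
  shows "0 < emeasure M (\<Inter>N. \<Union>q\<in>{N..}. E q)"
proof -
  have Ef: "E q \<in> fmeasurable M" for q
    using fmeasurableI2[OF U E(2,1)] .
  define V where "V N = (\<Union>q\<in>{N..}. E q)" for N
  have Vs: "V N \<in> sets M" for N unfolding V_def using E by auto
  have VU: "V N \<subseteq> U" for N unfolding V_def using E by auto
  have Vf: "V N \<in> fmeasurable M" for N
    using fmeasurableI2[OF U VU Vs] .
  have "ennreal (1 / (C + 1)) \<le> emeasure M (V N)" for N
  proof -
    obtain m where m: "(\<Sum>q\<in>{N..<m}. measure M (E q)) \<ge> 1"
    proof (rule ccontr)
      assume "\<not> thesis"
      with that have lt: "(\<Sum>q\<in>{N..<m}. measure M (E q)) < 1" for m by (meson not_le)
      have "summable (\<lambda>q. measure M (E (q + N)))"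
      proof (rule bounded_imp_summable)
        fix n
        have "(\<Sum>q\<le>n. measure M (E (q + N))) = (\<Sum>q\<in>{N..<Suc n + N}. measure M (E q))"
          using sum.shift_bounds_nat_ivl[of "\<lambda>q. measure M (E q)" 0 N "Suc n"]
          by (simp only: add_0 atLeast0LessThan lessThan_Suc_atMost)
        also have "\<dots> \<le> 1" using lt less_imp_le by blast
        finally show "(\<Sum>q\<le>n. measure M (E (q + N))) \<le> 1" .
      qed simp
      with div show False
        using summable_iff_shift[of "\<lambda>q. measure M (E q)" N] by simp
    qed
    have "1 / (C + 1) \<le> measure M (\<Union>q\<in>{N..<m}. E q)"
      using Ef C indep m by (intro measure_UN_ge_of_quasi_independent) auto
    also have "\<dots> \<le> measure M (V N)"
      using E Vf by (intro measure_mono_fmeasurable) (auto simp: V_def)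
    finally have "ennreal (1 / (C + 1)) \<le> ennreal (measure M (V N))"
      by (rule ennreal_leI)
    then show ?thesis using Vf by (simp add: emeasure_eq_measure2)
  qed
  then have "ennreal (1 / (C + 1)) \<le> (INF N. emeasure M (V N))"
    by (simp add: le_INF_iff)
  also have "\<dots> = emeasure M (\<Inter>N. V N)"
  proof (rule INF_emeasure_decseq)
    show "decseq V" unfolding decseq_def V_def by (intro allI impI UN_mono) auto
    show "emeasure M (V N) \<noteq> \<infinity>" for N
      using Vf[of N] by (simp add: fmeasurable_def less_top)
  qed (use Vs in auto)
  finally have *: "ennreal (1 / (C + 1)) \<le> emeasure M (\<Inter>N. V N)" .
  have "0 < ennreal (1 / (C + 1))" using C by simp
  from this * show ?thesis unfolding V_def by (rule less_le_trans)
qed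

section \<open>Affine maps, dyadic cubes and the zero-one law\<close>

text \<open>A product measure is determined by its values on boxes, where the claim is the
  one-dimensional rule in each coordinate. Later \<open>c = 2 ^ k\<close> blows a dyadic cube up to
  the unit cube, and \<open>c = 1\<close> translates.\<close>

lemma emeasure_PiM_lborel_affine:
  fixes c :: real and u :: "'i \<Rightarrow> real"
  assumes "finite I" "c > 0" and B: "B \<in> sets (\<Pi>\<^sub>M i\<in>I. lborel)"
  shows "emeasure (\<Pi>\<^sub>M i\<in>I. lborel) B =
    ennreal (c ^ card I) * emeasure (\<Pi>\<^sub>M i\<in>I. lborel) {y \<in> I \<rightarrow>\<^sub>E UNIV. (\<lambda>i\<in>I. c * y i + u i) \<in> B}"
proof -
  interpret product_sigma_finite "\<lambda>_::'i. lborel :: real measure" by standard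
  let ?L = "\<Pi>\<^sub>M i\<in>I. (lborel :: real measure)"
  define f where "f y = (\<lambda>i\<in>I. c * y i + u i)" for y
  have f [measurable]: "f \<in> measurable ?L ?L"
    unfolding f_def by measurable
  have "scale_measure (ennreal (c ^ card I)) (distr ?L ?L f) = ?L"
  proof (rule PiM_eqI)
    fix X :: "'i \<Rightarrow> real set" assume X: "\<And>i. i \<in> I \<Longrightarrow> X i \<in> sets lborel"
    have aff: "emeasure lborel (X i) = ennreal c * emeasure lborel {t. c * t + u i \<in> X i}" if "i \<in> I" for i
    proof -
      have [measurable]: "X i \<in> sets borel" using X[OF that] by simp
      have "emeasure lborel (X i) = emeasure (density (distr lborel borel (\<lambda>x. u i + c * x)) (\<lambda>_. ennreal \<bar>c\<bar>)) (X i)"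
        using lborel_real_affine[of c "u i"] assms by simp
      also have "\<dots> = ennreal c * emeasure lborel ((\<lambda>x. u i + c * x) -` X i)"
        using assms by (simp add: emeasure_density nn_integral_cmult emeasure_distr)
      finally show ?thesis by (simp add: vimage_def add.commute)
    qed
    have pre: "f -` Pi\<^sub>E I X \<inter> space ?L = Pi\<^sub>E I (\<lambda>i. {t. c * t + u i \<in> X i})"
      by (auto simp: f_def space_PiM PiE_iff)
    have meas: "{t. c * t + u i \<in> X i} \<in> sets lborel" if "i \<in> I" for i
    proof -
      have [measurable]: "X i \<in> sets borel" using X[OF that] by simp
      show ?thesis by simp
    qed
    have "emeasure (scale_measure (ennreal (c ^ card I)) (distr ?L ?L f)) (Pi\<^sub>E I X)
        = ennreal (c ^ card I) * (\<Prod>i\<in>I. emeasure lborel {t. c * t + u i \<in> X i})"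
      using assms(1) X meas
      by (simp add: emeasure_distr sets_PiM_I_finite pre emeasure_PiM)
    also have "\<dots> = (\<Prod>i\<in>I. emeasure lborel (X i))"
      using assms by (simp add: aff prod.distrib ennreal_power)
    finally show "emeasure (scale_measure (ennreal (c ^ card I)) (distr ?L ?L f)) (Pi\<^sub>E I X)
        = (\<Prod>i\<in>I. emeasure lborel (X i))" .
  qed (use assms in auto)
  then have "emeasure ?L B = emeasure (scale_measure (ennreal (c ^ card I)) (distr ?L ?L f)) B"
    by simp
  also have "\<dots> = ennreal (c ^ card I) * emeasure ?L (f -` B \<inter> space ?L)"
    using B by (simp add: emeasure_distr)
  also have "f -` B \<inter> space ?L = {y \<in> I \<rightarrow>\<^sub>E UNIV. (\<lambda>i\<in>I. c * y i + u i) \<in> B}"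
    by (auto simp: f_def space_PiM)
  finally show ?thesis .
qed

text \<open>Written with floors, nesting of cubes becomes integer division. Values of
  \<open>a\<close> outside \<open>I\<close> are ignored, so one cube has many indices unless
  \<open>a\<close> is restricted to \<open>I\<close>.\<close>

definition dyadic_cube :: "'i set \<Rightarrow> nat \<Rightarrow> ('i \<Rightarrow> int) \<Rightarrow> ('i \<Rightarrow> real) set" where
  "dyadic_cube I k a = {y \<in> I \<rightarrow>\<^sub>E UNIV. \<forall>i\<in>I. \<lfloor>2 ^ k * y i\<rfloor> = a i}"

lemma dyadic_cube_eq_PiE: "dyadic_cube I k a = Pi\<^sub>E I (\<lambda>i. {of_int (a i) / 2 ^ k ..< (of_int (a i) + 1) / 2 ^ k})"
  by (auto simp: dyadic_cube_def PiE_iff extensional_def floor_eq_iff field_simps)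

lemma sets_dyadic_cube [measurable]: "finite I \<Longrightarrow> dyadic_cube I k a \<in> sets (\<Pi>\<^sub>M i\<in>I. lborel)"
  unfolding dyadic_cube_eq_PiE by (rule sets_PiM_I_finite) auto

lemma emeasure_dyadic_cube:
  assumes "finite I"
  shows "emeasure (\<Pi>\<^sub>M i\<in>I. lborel) (dyadic_cube I k (a :: 'i \<Rightarrow> int)) = ennreal (1 / 2 ^ (k * card I))"
proof -
  interpret product_sigma_finite "\<lambda>_::'i. lborel :: real measure" by standard
  have "real_of_int (a i) / 2 ^ k \<le> (real_of_int (a i) + 1) / 2 ^ k" for i
    by (simp add: divide_right_mono)
  then show ?thesis
    using assms by (simp add: dyadic_cube_eq_PiE emeasure_PiM prod_ennreal power_mult power_one_over
        ennreal_power diff_divide_distrib[symmetric])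
qed

lemma floor_power2_div:
  fixes t :: real
  assumes "k \<le> l"
  shows "\<lfloor>2 ^ k * t\<rfloor> = \<lfloor>2 ^ l * t\<rfloor> div 2 ^ (l - k)"
proof -
  have "2 ^ k * t = (2 ^ l * t) / of_int (2 ^ (l - k))"
    using assms by (simp add: field_simps flip: power_add)
  then show ?thesis
    using floor_divide_real_eq_div[of "2 ^ (l - k)" "2 ^ l * t"] by simp
qed

text \<open>Dropping binary digits recovers the coarser floors from the finer ones, so they are
  constant on the finer cube, which is thus contained in the coarser one or disjoint from
  it.\<close>

lemma dyadic_cube_Int:
  assumes "k \<le> l"
  shows "dyadic_cube I k a \<inter> dyadic_cube I l b \<in> {{}, dyadic_cube I l b}"
  using floor_power2_div[OF assms] by (fastforce simp: dyadic_cube_def)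

text \<open>A half-space \<open>y i < b\<close> is the union of the dyadic cubes whose upper end in
  direction \<open>i\<close> is at most \<open>b\<close>. The empty set is added to make the
  generator stable under intersection.\<close>

lemma sigma_sets_dyadic_cubes:
  fixes I :: "'i set"
  assumes "finite I"
  shows "sets (\<Pi>\<^sub>M i\<in>I. lborel) = sigma_sets (I \<rightarrow>\<^sub>E UNIV) (insert {} (range (\<lambda>(k, a). dyadic_cube I k a)))"
    (is "_ = sigma_sets ?\<Omega> ?E")
proof (rule subset_antisym)
  have Esub: "?E \<subseteq> Pow ?\<Omega>" by (auto simp: dyadic_cube_def)
  have "?E \<subseteq> sets (\<Pi>\<^sub>M i\<in>I. lborel)" using assms by auto
  from sets.sigma_sets_subset[OF this] show "sigma_sets ?\<Omega> ?E \<subseteq> sets (\<Pi>\<^sub>M i\<in>I. lborel)"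
    by (simp add: space_PiM)
  define N where "N = sigma ?\<Omega> ?E"
  have N: "sets N = sigma_sets ?\<Omega> ?E" "space N = ?\<Omega>"
    using Esub by (simp_all add: N_def)
  have "sets (\<Pi>\<^sub>M i\<in>I. lborel) \<subseteq> sets N"
  proof (rule sets_PiM_in_sets)
    show "space N = (\<Pi>\<^sub>E i\<in>I. space (lborel :: real measure))" by (simp add: N)
    fix i :: 'i and X :: "real set" assume i: "i \<in> I" and X: "X \<in> sets lborel"
    have "(\<lambda>y. y i) \<in> borel_measurable N"
    proof (rule borel_measurableI_less)
      fix b :: real
      \<comment> \<open>Restricting \<open>a\<close> to extensional functions on the finite
        \<open>I\<close> makes the index set countable.\<close>
      define T where "T = {(k, a). a \<in> I \<rightarrow>\<^sub>E (UNIV :: int set) \<and> (of_int (a i) + 1) / 2 ^ k \<le> b}"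
      have "T \<subseteq> UNIV \<times> (I \<rightarrow>\<^sub>E (UNIV :: int set))" by (auto simp: T_def)
      moreover have "countable (UNIV \<times> (I \<rightarrow>\<^sub>E (UNIV :: int set)) :: (nat \<times> _) set)"
        using assms by (intro countable_SIGMA countable_PiE) auto
      ultimately have T: "countable T" by (rule countable_subset)
      have "{y \<in> space N. y i < b} = (\<Union>(k, a)\<in>T. dyadic_cube I k a)"
      proof safe
        fix y assume y: "y \<in> space N" "y i < b"
        then obtain k where k: "(1 / 2) ^ k < b - y i"
          using real_arch_pow_inv[of "b - y i" "1 / 2"] by auto
        define a where "a = (\<lambda>j\<in>I. \<lfloor>2 ^ k * y j\<rfloor>)"
        have "(of_int (a i) + 1) / 2 ^ k \<le> (2 ^ k * y i + 1) / 2 ^ k"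
          using i by (intro divide_right_mono) (auto simp: a_def)
        also have "\<dots> = y i + (1 / 2) ^ k" by (simp add: field_simps)
        also have "\<dots> \<le> b" using k by simp
        finally have "(k, a) \<in> T" by (simp add: T_def a_def)
        moreover have "y \<in> dyadic_cube I k a"
          using y by (auto simp: dyadic_cube_def a_def N)
        ultimately show "y \<in> (\<Union>(k, a)\<in>T. dyadic_cube I k a)" by blast
      next
        fix y k a assume T: "(k, a) \<in> T" and y: "y \<in> dyadic_cube I k a"
        show "y \<in> space N" using y by (simp add: N dyadic_cube_def)
        have "y i < (of_int (a i) + 1) / 2 ^ k"
          using y i by (auto simp: dyadic_cube_eq_PiE)
        also have "\<dots> \<le> b" using T by (simp add: T_def)
        finally show "y i < b" .
      qed
      also have "\<dots> \<in> sets N"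
      proof (rule sets.countable_UN''[OF T])
        show "(case z of (k, a) \<Rightarrow> dyadic_cube I k a) \<in> sets N" if "z \<in> T" for z
          unfolding N by (rule sigma_sets.Basic) (cases z, auto)
      qed
      finally show "{y \<in> space N. y i < b} \<in> sets N" .
    qed
    from measurable_sets[OF this, of X] X
    show "{y \<in> space N. y i \<in> X} \<in> sets N" by (simp add: vimage_def Int_def conj_commute)
  qed
  then show "sets (\<Pi>\<^sub>M i\<in>I. lborel) \<subseteq> sigma_sets ?\<Omega> ?E" by (simp add: N)
qed

text \<open>A zero-one law: invariance makes the density of \<open>A\<close> in every dyadic cube the same,
  so \<open>A\<close> is independent of the dyadic cubes and hence of itself.\<close>

lemma AE_of_doubling_invariant:
  fixes I :: "'i set" and A :: "('i \<Rightarrow> real) set"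
  assumes I: "finite I" and A [measurable]: "A \<in> sets (\<Pi>\<^sub>M i\<in>I. lborel)"
    and shift: "\<And>y (a :: 'i \<Rightarrow> int). y \<in> A \<Longrightarrow> (\<lambda>i\<in>I. y i + of_int (a i)) \<in> A"
    and doubling: "\<And>y. y \<in> A \<Longrightarrow> (\<lambda>i\<in>I. 2 * y i) \<in> A"
    and pos: "0 < emeasure (\<Pi>\<^sub>M i\<in>I. lborel) (A \<inter> (I \<rightarrow>\<^sub>E {0..<1}))"
  shows "AE y in (\<Pi>\<^sub>M i\<in>I. lborel). y \<in> A"
proof -
  let ?L = "\<Pi>\<^sub>M i\<in>I. (lborel :: real measure)"
  let ?U = "dyadic_cube I 0 (\<lambda>_. 0)"
  have A_ext: "y \<in> I \<rightarrow>\<^sub>E UNIV" if "y \<in> A" for y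
    using sets.sets_into_space[OF A] that by (auto simp: space_PiM)
  have dc [measurable]: "dyadic_cube I k a \<in> sets ?L" for k a
    using I by (rule sets_dyadic_cube)
  have fm: "dyadic_cube I k a \<in> fmeasurable ?L" for k a
    using I by (intro fmeasurableI) (auto simp: emeasure_dyadic_cube)
  have fmA: "A \<inter> dyadic_cube I k a \<in> fmeasurable ?L" for k a
    by (rule fmeasurableI2[OF fm]) auto
  define \<alpha> where "\<alpha> = measure ?L (A \<inter> ?U)"
  have em: "emeasure ?L (A \<inter> dyadic_cube I k a) = ennreal (measure ?L (A \<inter> dyadic_cube I k a))" for k a
    using fmA by (simp add: emeasure_eq_measure2)
  have "?U = I \<rightarrow>\<^sub>E {0..<1}" by (simp add: dyadic_cube_eq_PiE)
  with pos have "0 < emeasure ?L (A \<inter> ?U)" by simp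
  then have \<alpha>: "\<alpha> > 0" unfolding em \<alpha>_def by simp
  have pow: "(\<lambda>i\<in>I. 2 ^ k * y i) \<in> A" if "y \<in> A" for k y
  proof (induction k)
    case 0
    have "(\<lambda>i\<in>I. y i) = y" using A_ext[OF that] by (auto simp: fun_eq_iff PiE_iff extensional_def)
    with that show ?case by simp
  next
    case (Suc k)
    have "(\<lambda>i\<in>I. 2 ^ Suc k * y i) = (\<lambda>i\<in>I. 2 * (\<lambda>i\<in>I. 2 ^ k * y i) i)" by auto
    with doubling[OF Suc] show ?case by metis
  qed
  \<comment> \<open>The map \<open>y \<mapsto> 2 ^ k * y - a\<close> sends \<open>A\<close> within
    the cube into \<open>A\<close> within the unit cube and multiplies volume by
    \<open>2 ^ (k * card I)\<close>. Invariance goes one way only, whence an inequality.\<close>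
  have upper: "measure ?L (A \<inter> dyadic_cube I k a) \<le> \<alpha> / 2 ^ (k * card I)" for k a
  proof -
    let ?B = "{y \<in> I \<rightarrow>\<^sub>E UNIV. (\<lambda>i\<in>I. 2 ^ k * y i + - of_int (a i)) \<in> A \<inter> ?U}"
    have B: "?B \<in> sets ?L"
    proof -
      have f: "(\<lambda>y. \<lambda>i\<in>I. 2 ^ k * y i + - of_int (a i)) \<in> measurable ?L ?L" by measurable
      have "(\<lambda>y. \<lambda>i\<in>I. 2 ^ k * y i + - of_int (a i)) -` (A \<inter> ?U) \<inter> space ?L \<in> sets ?L"
        by (rule measurable_sets[OF f]) measurable
      then show ?thesis by (simp add: vimage_def Int_def space_PiM conj_commute)
    qed
    have "A \<inter> dyadic_cube I k a \<subseteq> ?B"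
    proof
      fix y assume y: "y \<in> A \<inter> dyadic_cube I k a"
      have "(\<lambda>i\<in>I. 2 ^ k * y i + - of_int (a i)) \<in> A"
        using shift[OF pow, of y k "\<lambda>i. - a i"] y by (simp cong: restrict_cong)
      then show "y \<in> ?B" using y by (auto simp: dyadic_cube_def)
    qed
    then have "emeasure ?L (A \<inter> dyadic_cube I k a) \<le> emeasure ?L ?B"
      using B by (rule emeasure_mono)
    then have "ennreal ((2 ^ k) ^ card I) * emeasure ?L (A \<inter> dyadic_cube I k a)
        \<le> ennreal ((2 ^ k) ^ card I) * emeasure ?L ?B"
      by (rule mult_left_mono) simp
    also have "\<dots> = emeasure ?L (A \<inter> ?U)"
      by (rule emeasure_PiM_lborel_affine[symmetric]) (use I in auto)
    finally show ?thesis
      by (simp add: em \<alpha>_def power_mult field_simps flip: ennreal_mult)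
  qed
  have unit: "measure ?L (A \<inter> dyadic_cube I 0 a) = \<alpha>" for a
  proof -
    have "{y \<in> I \<rightarrow>\<^sub>E UNIV. (\<lambda>i\<in>I. 1 * y i + - of_int (a i)) \<in> A \<inter> ?U} = A \<inter> dyadic_cube I 0 a"
    proof safe
      fix y :: "'i \<Rightarrow> real" assume y: "y \<in> I \<rightarrow>\<^sub>E UNIV" and *: "(\<lambda>i\<in>I. 1 * y i + - of_int (a i)) \<in> A"
      have "(\<lambda>i\<in>I. (\<lambda>i\<in>I. 1 * y i + - of_int (a i)) i + of_int (a i)) = y"
        using y by (auto simp: fun_eq_iff PiE_iff extensional_def)
      with shift[OF *, of a] show "y \<in> A" by simp
    next
      fix y assume "y \<in> A"
      from shift[OF this, of "\<lambda>i. - a i"]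
      show "(\<lambda>i\<in>I. 1 * y i + - of_int (a i)) \<in> A" by simp
    qed (auto simp: dyadic_cube_def dest: A_ext)
    with emeasure_PiM_lborel_affine[OF I, of 1 "A \<inter> ?U" "\<lambda>i. - of_int (a i)"]
    have "emeasure ?L (A \<inter> ?U) = emeasure ?L (A \<inter> dyadic_cube I 0 a)" by simp
    then show ?thesis by (simp add: \<alpha>_def measure_def)
  qed
  \<comment> \<open>The \<open>2 ^ (k * card I)\<close> subcubes of a unit cube share the total
    \<open>\<alpha>\<close>, and none exceeds the average by \<open>upper\<close>; so each attains
    it.\<close>
  have lower: "\<alpha> / 2 ^ (k * card I) \<le> measure ?L (A \<inter> dyadic_cube I k a)" for k a
  proof -
    define b where "b i = a i div 2 ^ k" for i
    define S where "S = (\<Pi>\<^sub>E i\<in>I. {2 ^ k * b i ..< 2 ^ k * b i + 2 ^ k})"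
    define a' where "a' = restrict a I"
    have finS: "finite S" unfolding S_def using I by (intro finite_PiE) auto
    have cS: "real (card S) = 2 ^ (k * card I)"
      unfolding S_def using I by (simp add: card_PiE power_mult nat_power_eq)
    have "2 ^ k * (a i div 2 ^ k) \<le> a i \<and> a i < 2 ^ k * (a i div 2 ^ k) + 2 ^ k" for i
      using pos_mod_bound[of "2 ^ k" "a i"] pos_mod_sign[of "2 ^ k" "a i"] mult_div_mod_eq[of "2 ^ k" "a i"]
      by (smt (verit) zero_less_power)
    then have a'S: "a' \<in> S" by (auto simp: a'_def S_def b_def)
    have cov: "A \<inter> dyadic_cube I 0 b \<subseteq> (\<Union>c\<in>S. A \<inter> dyadic_cube I k c)"
    proof
      fix y assume y: "y \<in> A \<inter> dyadic_cube I 0 b"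
      define c where "c = (\<lambda>i\<in>I. \<lfloor>2 ^ k * y i\<rfloor>)"
      have "c \<in> S"
        unfolding S_def
      proof (rule PiE_I)
        fix i assume i: "i \<in> I"
        have "real_of_int (b i) \<le> y i" "y i < real_of_int (b i) + 1"
          using y i by (auto simp: dyadic_cube_eq_PiE)
        then have "2 ^ k * real_of_int (b i) \<le> 2 ^ k * y i" "2 ^ k * y i < 2 ^ k * (real_of_int (b i) + 1)"
          by simp_all
        then have "real_of_int (2 ^ k * b i) \<le> 2 ^ k * y i" "2 ^ k * y i < real_of_int (2 ^ k * b i + 2 ^ k)"
          by (simp_all add: algebra_simps)
        then show "c i \<in> {2 ^ k * b i ..< 2 ^ k * b i + 2 ^ k}"
          using i by (simp add: c_def le_floor_iff floor_less_iff)
      qed (simp add: c_def)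
      moreover have "y \<in> dyadic_cube I k c"
        using y by (auto simp: dyadic_cube_def c_def)
      ultimately show "y \<in> (\<Union>c\<in>S. A \<inter> dyadic_cube I k c)" using y by blast
    qed
    have "\<alpha> = measure ?L (A \<inter> dyadic_cube I 0 b)" by (simp add: unit)
    also have "\<dots> \<le> measure ?L (\<Union>c\<in>S. A \<inter> dyadic_cube I k c)"
      using cov finS fmA by (intro measure_mono_fmeasurable fmeasurable.finite_UN) auto
    also have "\<dots> \<le> (\<Sum>c\<in>S. measure ?L (A \<inter> dyadic_cube I k c))"
      using finS fmA by (intro measure_UNION_le) (auto intro: fmeasurableD)
    also have "\<dots> = measure ?L (A \<inter> dyadic_cube I k a') + (\<Sum>c\<in>S - {a'}. measure ?L (A \<inter> dyadic_cube I k c))"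
      using finS a'S by (rule sum.remove)
    also have "(\<Sum>c\<in>S - {a'}. measure ?L (A \<inter> dyadic_cube I k c)) \<le> (\<Sum>c\<in>S - {a'}. \<alpha> / 2 ^ (k * card I))"
      by (intro sum_mono upper)
    also have "\<dots> = (real (card S) - 1) * (\<alpha> / 2 ^ (k * card I))"
      using finS a'S card_gt_0_iff[of S] by (auto simp: card_Diff_singleton of_nat_diff Suc_leI)
    also have "\<dots> = \<alpha> - \<alpha> / 2 ^ (k * card I)"
      by (simp add: cS field_simps)
    also have "dyadic_cube I k a' = dyadic_cube I k a"
      by (auto simp: dyadic_cube_def a'_def)
    finally show ?thesis by simp
  qed
  have cube: "emeasure ?L (A \<inter> dyadic_cube I k a) = ennreal \<alpha> * emeasure ?L (dyadic_cube I k a)" for k a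
    using upper[of k a] lower[of k a] \<alpha> I
    by (simp add: em emeasure_dyadic_cube antisym flip: ennreal_mult)
  \<comment> \<open>Equal density on all cubes means that restricting Lebesgue measure to
    \<open>A\<close> and multiplying it by \<open>\<alpha>\<close> agree on a generator, hence on
    all measurable sets. On the complement of \<open>A\<close> the former is 0, and
    \<open>\<alpha> > 0\<close>.\<close>
  have "density ?L (indicator A) = density ?L (\<lambda>_. ennreal \<alpha>)"
  proof (rule measure_eqI_generator_eq_countable)
    let ?E = "insert {} (range (\<lambda>(k, a). dyadic_cube I k a))"
    show "Int_stable ?E"
    proof (rule Int_stableI)
      have *: "dyadic_cube I k a \<inter> dyadic_cube I l b \<in> ?E" for k l a b
      proof (cases "k \<le> l")
        case True
        then show ?thesis using dyadic_cube_Int[OF True, of I a b] by auto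
      next
        case False
        then show ?thesis using dyadic_cube_Int[of l k I b a] by (auto simp: Int_commute)
      qed
      fix X Y assume "X \<in> ?E" "Y \<in> ?E"
      then consider "X = {} \<or> Y = {}"
        | k a l b where "X = dyadic_cube I k a" "Y = dyadic_cube I l b" by auto
      then show "X \<inter> Y \<in> ?E"
      proof cases
        case 2
        show ?thesis unfolding 2 by (rule *)
      qed auto
    qed
    show "?E \<subseteq> Pow (I \<rightarrow>\<^sub>E UNIV)" by (auto simp: dyadic_cube_def)
    show "emeasure (density ?L (indicator A)) X = emeasure (density ?L (\<lambda>_. ennreal \<alpha>)) X"
      if "X \<in> ?E" for X
      using that cube
      by (auto simp: emeasure_density nn_integral_cmult indicator_inter_arith[symmetric])
    show "sets (density ?L (indicator A)) = sigma_sets (I \<rightarrow>\<^sub>E UNIV) ?E"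
      "sets (density ?L (\<lambda>_. ennreal \<alpha>)) = sigma_sets (I \<rightarrow>\<^sub>E UNIV) ?E"
      using sigma_sets_dyadic_cubes[OF I] by simp_all
    show "dyadic_cube I 0 ` (I \<rightarrow>\<^sub>E UNIV) \<subseteq> ?E" by auto
    show "\<Union> (dyadic_cube I 0 ` (I \<rightarrow>\<^sub>E UNIV)) = I \<rightarrow>\<^sub>E UNIV"
    proof safe
      fix y :: "'i \<Rightarrow> real" assume y: "y \<in> I \<rightarrow>\<^sub>E UNIV"
      then have "y \<in> dyadic_cube I 0 (\<lambda>i\<in>I. \<lfloor>y i\<rfloor>)" by (auto simp: dyadic_cube_def)
      then show "y \<in> \<Union> (dyadic_cube I 0 ` (I \<rightarrow>\<^sub>E UNIV))" by fastforce
    qed (auto simp: dyadic_cube_def)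
    show "countable (dyadic_cube I 0 ` (I \<rightarrow>\<^sub>E UNIV))"
      using I by (intro countable_image countable_PiE) auto
    show "emeasure (density ?L (indicator A)) X \<noteq> \<infinity>" if "X \<in> dyadic_cube I 0 ` (I \<rightarrow>\<^sub>E UNIV)" for X
      using that em by (auto simp: emeasure_density indicator_inter_arith[symmetric])
  qed
  then have "emeasure (density ?L (indicator A)) (space ?L - A) = emeasure (density ?L (\<lambda>_. ennreal \<alpha>)) (space ?L - A)"
    by simp
  then have "ennreal \<alpha> * emeasure ?L (space ?L - A) = 0"
    by (simp add: emeasure_density nn_integral_cmult indicator_inter_arith[symmetric])
  then have "emeasure ?L (space ?L - A) = 0" using \<alpha> by auto
  then show ?thesis by (intro AE_I[of _ _ "space ?L - A"]) auto
qed

section \<open>Gallagher's theorem\<close>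

text \<open>The set consists of one interval of length \<open>\<delta> / q\<close> per numerator in
  \<open>P\<close>. The bound \<open>\<delta> \<le> 1\<close> keeps these intervals disjoint and, as
  \<open>p + 1 \<le> q\<close>, inside the unit interval.\<close>

lemma floor_frac_measure:
  fixes q :: nat and P :: "int set" and \<delta> :: real
  assumes q: "q > 0" and \<delta>: "0 \<le> \<delta>" "\<delta> \<le> 1" and P: "P \<subseteq> {0..<int q}"
  defines "D \<equiv> {t \<in> {0..<1::real}. \<lfloor>real q * t\<rfloor> \<in> P \<and> frac (real q * t) < \<delta>}"
  shows "D \<in> sets lborel" "emeasure lborel D = ennreal (real (card P) * \<delta> / real q)"
proof -
  have finP: "finite P" using P by (rule finite_subset) auto
  have D: "D = (\<Union>p\<in>P. {of_int p / real q ..< (of_int p + \<delta>) / real q})" (is "_ = (\<Union>p\<in>P. ?J p)")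
  proof safe
    fix t assume "t \<in> D"
    then show "t \<in> (\<Union>p\<in>P. ?J p)"
      using q by (auto simp: D_def frac_def field_simps intro!: bexI[of _ "\<lfloor>real q * t\<rfloor>"])
  next
    fix t p assume p: "p \<in> P" and t: "t \<in> ?J p"
    then have "of_int p \<le> real q * t" "real q * t < of_int p + \<delta>"
      using q by (auto simp: field_simps)
    then have fl: "\<lfloor>real q * t\<rfloor> = p" using \<delta> by linarith
    have "0 \<le> p" "p + 1 \<le> int q" using p P by auto
    then have "0 \<le> real_of_int p" "real_of_int p + 1 \<le> real q" by linarith+
    moreover have "0 \<le> real_of_int p / real q" "(of_int p + \<delta>) / real q \<le> 1"
      using calculation \<delta> q by (auto simp: field_simps)
    moreover have "of_int p / real q \<le> t" "t < (of_int p + \<delta>) / real q" using t by auto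
    ultimately have "0 \<le> t" "t < 1" by linarith+
    then show "t \<in> D"
      using fl p \<open>real q * t < of_int p + \<delta>\<close> by (simp add: D_def frac_def)
  qed
  then show "D \<in> sets lborel" using finP by auto
  have "disjoint_family_on ?J P"
  proof (unfold disjoint_family_on_def, intro ballI impI)
    fix p p' :: int assume "p \<noteq> p'"
    show "?J p \<inter> ?J p' = {}"
    proof (rule ccontr)
      assume "?J p \<inter> ?J p' \<noteq> {}"
      then obtain t where "t \<in> ?J p" "t \<in> ?J p'" by blast
      then have "of_int p \<le> real q * t" "real q * t < of_int p + \<delta>"
        "of_int p' \<le> real q * t" "real q * t < of_int p' + \<delta>"
        using q by (auto simp: field_simps)
      then have "p = p'" using \<delta> by linarith
      with \<open>p \<noteq> p'\<close> show False by contradiction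
    qed
  qed
  then have "emeasure lborel D = (\<Sum>p\<in>P. emeasure lborel (?J p))"
    unfolding D using finP by (subst sum_emeasure) auto
  also have "\<dots> = (\<Sum>p\<in>P. ennreal (\<delta> / real q))"
  proof (rule sum.cong)
    fix p
    have "real_of_int p / real q \<le> (of_int p + \<delta>) / real q"
      using \<delta> by (intro divide_right_mono) auto
    then show "emeasure lborel (?J p) = ennreal (\<delta> / real q)"
      by (simp flip: diff_divide_distrib)
  qed simp
  also have "\<dots> = ennreal (real (card P) * \<delta> / real q)"
    using \<delta> by (simp add: ennreal_of_nat_eq_real_of_nat flip: ennreal_mult)
  finally show "emeasure lborel D = ennreal (real (card P) * \<delta> / real q)" .
qed

text \<open>For \<open>0 \<le> \<delta> \<le> 1\<close> and \<open>q > 0\<close> this is the union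
  of \<open>[p / q, (p + \<delta>) / q)\<close> over the multiples \<open>p\<close> of
  \<open>l\<close> among \<open>0, ..., q - 1\<close>; \<open>l = 1\<close> gives all
  numerators.\<close>

definition near_numerators :: "nat \<Rightarrow> nat \<Rightarrow> real \<Rightarrow> real set" where
  "near_numerators l q \<delta> = {t \<in> {0..<1}. int l dvd \<lfloor>real q * t\<rfloor> \<and> frac (real q * t) < \<delta>}"

lemma
  assumes q: "q > 0" and \<delta>: "0 \<le> \<delta>" "\<delta> \<le> 1" and l: "l dvd q"
  shows sets_near_numerators: "near_numerators l q \<delta> \<in> sets borel"
    and emeasure_near_numerators: "emeasure lborel (near_numerators l q \<delta>) = ennreal (\<delta> / real l)"
proof -
  obtain m where m: "q = l * m" using l by blast
  have pos: "l > 0" "m > 0" using q m by auto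
  define P where "P = {p \<in> {0..<int q}. int l dvd p}"
  have eq: "near_numerators l q \<delta> = {t \<in> {0..<1::real}. \<lfloor>real q * t\<rfloor> \<in> P \<and> frac (real q * t) < \<delta>}"
    using q by (auto simp: near_numerators_def P_def floor_less_iff)
  have P: "P \<subseteq> {0..<int q}" by (auto simp: P_def)
  have "P = (\<lambda>j. int l * int j) ` {..<m}"
  proof safe
    fix p assume p: "p \<in> P"
    then obtain j where j: "p = int l * j" by (auto simp: P_def)
    with p pos have "0 \<le> j" "j < int m" by (auto simp: P_def m zero_le_mult_iff)
    then show "p \<in> (\<lambda>j. int l * int j) ` {..<m}"
      using j by (intro image_eqI[of _ _ "nat j"]) auto
  qed (use pos in \<open>auto simp: P_def m simp flip: of_nat_mult\<close>)
  then have "card P = m" using pos by (auto simp: card_image inj_on_def)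
  then have "real (card P) * \<delta> / real q = \<delta> / real l" using pos by (simp add: m)
  then show "near_numerators l q \<delta> \<in> sets borel"
    "emeasure lborel (near_numerators l q \<delta>) = ennreal (\<delta> / real l)"
    using floor_frac_measure[OF q \<delta> P] by (simp_all add: eq)
qed

section \<open>Overlap of neighbourhoods of rationals in one dimension\<close>

text \<open>With \<open>q = g * u\<close>, \<open>r = g * v\<close> and \<open>u\<close>,
  \<open>v\<close> coprime, the difference is \<open>g * (p * v - p' * u)\<close>. The second factor
  takes at most \<open>2 * X / g + 1\<close> values, and each fixes \<open>p\<close> modulo
  \<open>u\<close>, leaving \<open>g\<close> choices of \<open>p\<close>. The total
  \<open>2 * X + g\<close> is at most \<open>3 * X\<close> because \<open>g \<le> X\<close>.\<close>

lemma card_close_fractions_le: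
  fixes q r :: nat and X :: real
  assumes qr: "q > 0" "r > 0" and X: "real (gcd q r) \<le> X"
  defines "S \<equiv> {(p, p'). p \<in> {0..<int q} \<and> p' \<in> {0..<int r} \<and> \<bar>real_of_int (p * int r - p' * int q)\<bar> < X}"
  shows "finite S" "real (card S) \<le> 3 * X"
proof -
  define g where "g = gcd (int q) (int r)"
  have g: "g > 0" "real_of_int g = real (gcd q r)" using qr by (simp_all add: g_def)
  have "\<exists>u v. int q = u * g \<and> int r = v * g \<and> coprime u v"
    unfolding g_def by (rule gcd_coprime_exists) (use qr in simp)
  then obtain u v where uv: "int q = g * u" "int r = g * v" "coprime u v"
    by (metis mult.commute)
  have u: "u > 0" using uv(1) g qr by (metis of_nat_0_less_iff zero_less_mult_pos)
  have v: "v > 0" using uv(2) g qr by (metis of_nat_0_less_iff zero_less_mult_pos)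
  define M where "M = \<lfloor>X / real_of_int g\<rfloor>"
  define f where "f = (\<lambda>(p, p'). (p * v - p' * u, p div u))"
  have dif: "p * int r - p' * int q = g * (p * v - p' * u)" for p p'
    by (simp add: uv algebra_simps)
  have img: "f ` S \<subseteq> {-M..M} \<times> {0..<g}"
  proof safe
    fix p p' k l assume "(p, p') \<in> S" and "(k, l) = f (p, p')"
    then have kl: "k = p * v - p' * u" "l = p div u" and p: "0 \<le> p" "p < g * u"
      and "\<bar>real_of_int (p * int r - p' * int q)\<bar> < X"
      by (auto simp: S_def f_def uv(1))
    then have lt: "\<bar>real_of_int (g * k)\<bar> < X" by (simp only: dif kl(1))
    have "real_of_int \<bar>k\<bar> * real_of_int g < X" using lt g(1) by (simp add: abs_mult mult.commute)
    then have "real_of_int \<bar>k\<bar> \<le> X / real_of_int g" using g(1) by (simp add: field_simps)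
    then have "\<bar>k\<bar> \<le> M" by (simp add: M_def le_floor_iff)
    then show "k \<in> {-M..M}" by auto
    have "u * (p div u) \<le> p"
      using mult_div_mod_eq[of u p] pos_mod_sign[OF u, of p] by linarith
    then have "u * (p div u) < u * g" using p by (simp add: mult.commute)
    then have "p div u < g" using u by simp
    then show "l \<in> {0..<g}" using p u kl by (simp add: pos_imp_zdiv_nonneg_iff)
  qed
  have inj: "inj_on f S"
  proof (rule inj_onI, clarify)
    fix p p' s s' assume "f (p, p') = f (s, s')"
    then have e: "(p - s) * v = (p' - s') * u" "p div u = s div u"
      by (auto simp: f_def algebra_simps)
    then have "u dvd (p - s) * v" by simp
    then have "u dvd p - s" using uv(3) by (simp add: coprime_dvd_mult_left_iff)
    then have "p mod u = s mod u" by (simp add: mod_eq_dvd_iff)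
    with e(2) have "p = s" by (metis mult_div_mod_eq)
    with e(1) u show "p = s \<and> p' = s'" by simp
  qed
  have "S \<subseteq> {0..<int q} \<times> {0..<int r}" by (auto simp: S_def)
  then show "finite S" by (rule finite_subset) auto
  have "card S \<le> card ({-M..M} \<times> {0..<g})"
    using card_inj_on_le[OF inj img] by simp
  then have "card S \<le> nat (2 * M + 1) * nat g"
    by (simp add: card_cartesian_product algebra_simps)
  then have "real (card S) \<le> real (nat (2 * M + 1) * nat g)"
    by (rule of_nat_mono)
  also have "\<dots> \<le> (2 * (X / real_of_int g) + 1) * real_of_int g"
  proof -
    have "M \<ge> 0" using X g by (simp add: M_def)
    then have "real (nat (2 * M + 1) * nat g) = (2 * real_of_int M + 1) * real_of_int g"
      using g(1) by simp
    also have "\<dots> \<le> (2 * (X / real_of_int g) + 1) * real_of_int g"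
      using g(1) by (intro mult_right_mono add_right_mono mult_left_mono) (auto simp: M_def)
    finally show ?thesis .
  qed
  also have "\<dots> = 2 * X + real_of_int g" using g(1) by (simp add: field_simps)
  also have "\<dots> \<le> 3 * X" using X g by simp
  finally show "real (card S) \<le> 3 * X" .
qed

text \<open>The difference equals \<open>q * frac (r * t) - r * frac (q * t)\<close>. Both terms are
  nonnegative, so the bound is a maximum and not a sum.\<close>

lemma close_fractions:
  fixes q r :: nat and t \<delta> \<epsilon> :: real
  assumes qr: "q > 0" "r > 0" and fr: "frac (real q * t) < \<delta>" "frac (real r * t) < \<epsilon>"
  shows "\<bar>real_of_int (\<lfloor>real q * t\<rfloor> * int r - \<lfloor>real r * t\<rfloor> * int q)\<bar> < max (\<delta> * real r) (\<epsilon> * real q)"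
proof -
  have eq: "real_of_int (\<lfloor>real q * t\<rfloor> * int r - \<lfloor>real r * t\<rfloor> * int q)
      = real q * frac (real r * t) - real r * frac (real q * t)"
    by (simp add: frac_def algebra_simps)
  have "real r * frac (real q * t) < \<delta> * real r" "real q * frac (real r * t) < \<epsilon> * real q"
    using qr fr by (simp_all add: mult.commute)
  moreover have "0 \<le> real r * frac (real q * t)" "0 \<le> real q * frac (real r * t)" by simp_all
  ultimately show ?thesis unfolding eq by linarith
qed

text \<open>About \<open>X\<close> pairs of intervals can meet, each in length at most the shorter
  of the two, and \<open>X * w = \<delta> * \<epsilon>\<close>. If \<open>X\<close> were below the
  gcd, the common centres \<open>p / q = p' / r\<close> alone could exceed this; coprimality is what
  excludes that case later.\<close>

lemma emeasure_near_numerators_Int: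
  fixes q r :: nat and \<delta> \<epsilon> :: real
  assumes qr: "q > 0" "r > 0" and \<delta>: "0 \<le> \<delta>" "\<delta> \<le> 1" and \<epsilon>: "0 \<le> \<epsilon>" "\<epsilon> \<le> 1"
    and X: "real (gcd q r) \<le> max (\<delta> * real r) (\<epsilon> * real q)"
  shows "emeasure lborel (near_numerators 1 q \<delta> \<inter> near_numerators 1 r \<epsilon>) \<le> ennreal (3 * \<delta> * \<epsilon>)"
proof -
  define X where "X = max (\<delta> * real r) (\<epsilon> * real q)"
  define w where "w = min (\<delta> / real q) (\<epsilon> / real r)"
  define S where "S = {(p, p'). p \<in> {0..<int q} \<and> p' \<in> {0..<int r} \<and> \<bar>real_of_int (p * int r - p' * int q)\<bar> < X}"
  note S = card_close_fractions_le[OF qr X, folded X_def, folded S_def]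
  have w0: "w \<ge> 0" using \<delta> \<epsilon> by (simp add: w_def)
  have Xw: "X * w = \<delta> * \<epsilon>"
    using qr by (cases "\<delta> * real r \<le> \<epsilon> * real q") (auto simp: X_def w_def min_def max_def field_simps)
  define B where "B = (\<lambda>(p, p'). {of_int p / real q ..< (of_int p + \<delta>) / real q}
     \<inter> {of_int p' / real r ..< (of_int p' + \<epsilon>) / real r})"
  have "near_numerators 1 q \<delta> \<inter> near_numerators 1 r \<epsilon> \<subseteq> (\<Union>z\<in>S. B z)"
  proof
    fix t assume t: "t \<in> near_numerators 1 q \<delta> \<inter> near_numerators 1 r \<epsilon>"
    then have t01: "0 \<le> t" "t < 1" and fr: "frac (real q * t) < \<delta>" "frac (real r * t) < \<epsilon>"
      by (auto simp: near_numerators_def)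
    have "(\<lfloor>real q * t\<rfloor>, \<lfloor>real r * t\<rfloor>) \<in> S"
      using t01 qr close_fractions[OF qr fr]
      by (auto simp: S_def X_def floor_less_iff)
    moreover have "t \<in> B (\<lfloor>real q * t\<rfloor>, \<lfloor>real r * t\<rfloor>)"
      using fr qr by (auto simp: B_def frac_def field_simps)
    ultimately show "t \<in> (\<Union>z\<in>S. B z)" by blast
  qed
  then have "emeasure lborel (near_numerators 1 q \<delta> \<inter> near_numerators 1 r \<epsilon>) \<le> emeasure lborel (\<Union>z\<in>S. B z)"
    using S(1) by (intro emeasure_mono sets.finite_UN) (auto simp: B_def)
  also have "\<dots> \<le> (\<Sum>z\<in>S. emeasure lborel (B z))"
    using S(1) by (intro emeasure_subadditive_finite) (auto simp: B_def)
  also have "\<dots> \<le> (\<Sum>z\<in>S. ennreal w)"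
  proof (rule sum_mono)
    fix z :: "int \<times> int"
    obtain p p' where z: "z = (p, p')" by (cases z)
    have "emeasure lborel (B z) \<le> emeasure lborel {of_int p / real q ..< (of_int p + \<delta>) / real q}"
      by (intro emeasure_mono) (auto simp: B_def z)
    also have "\<dots> = ennreal (\<delta> / real q)"
      using \<delta> by (subst emeasure_lborel_Ico) (auto simp: divide_right_mono simp flip: diff_divide_distrib)
    finally have 1: "emeasure lborel (B z) \<le> ennreal (\<delta> / real q)" .
    have "emeasure lborel (B z) \<le> emeasure lborel {of_int p' / real r ..< (of_int p' + \<epsilon>) / real r}"
      by (intro emeasure_mono) (auto simp: B_def z)
    also have "\<dots> = ennreal (\<epsilon> / real r)"
      using \<epsilon> by (subst emeasure_lborel_Ico) (auto simp: divide_right_mono simp flip: diff_divide_distrib)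
    finally show "emeasure lborel (B z) \<le> ennreal w" using 1 by (simp add: w_def min_def)
  qed
  also have "\<dots> = ennreal (real (card S) * w)"
    using w0 by (simp add: ennreal_of_nat_eq_real_of_nat flip: ennreal_mult)
  also have "\<dots> \<le> ennreal (3 * X * w)"
    using S(2) w0 by (intro ennreal_leI mult_right_mono) auto
  also have "3 * X * w = 3 * \<delta> * \<epsilon>" using Xw by simp
  finally show ?thesis .
qed

text \<open>Telescoping from \<open>1 / 4 = 3 / 4 - 1 / 2\<close> at \<open>q = 2\<close>. The
  constant must be below 1, so that a positive proportion survives the removal of common
  divisors.\<close>

lemma sum_inverse_squares_le: "(\<Sum>l=2..q. 1 / (real l)\<^sup>2) \<le> 3 / 4"
proof -
  have "(\<Sum>l=2..q. 1 / (real l)\<^sup>2) \<le> 3 / 4 - 1 / real q" if "q \<ge> 2"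
    using that
  proof (induction q rule: dec_induct)
    case (step n)
    have "1 / (real (Suc n))\<^sup>2 \<le> 1 / (real n * real (Suc n))"
      using step by (intro divide_left_mono) (auto simp: power2_eq_square)
    also have "\<dots> = 1 / real n - 1 / real (Suc n)"
      using step by (simp add: field_simps)
    finally have "1 / (real (Suc n))\<^sup>2 \<le> 1 / real n - 1 / real (Suc n)" .
    moreover have "(\<Sum>l=2..Suc n. 1 / (real l)\<^sup>2) = (\<Sum>l=2..n. 1 / (real l)\<^sup>2) + 1 / (real (Suc n))\<^sup>2"
      using step by simp
    ultimately show ?case using step.IH by linarith
  qed simp
  moreover have "0 \<le> 1 / real q" by simp
  ultimately show ?thesis by (cases "q \<ge> 2") (linarith, simp)
qed

text \<open>One-sided intervals \<open>[p / q, (p + \<delta>) / q)\<close> keep these sets inside the unit cube, so that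
  nothing wraps around modulo 1. Only the numerators at \<open>a\<close> and \<open>b\<close> have to be jointly coprime
  to \<open>q\<close>.\<close>

definition coprime_near :: "'i \<Rightarrow> 'i \<Rightarrow> 'i set \<Rightarrow> nat \<Rightarrow> real \<Rightarrow> ('i \<Rightarrow> real) set" where
  "coprime_near a b I q \<delta> = (I \<rightarrow>\<^sub>E near_numerators 1 q \<delta>) -
     (\<Union>l\<in>{l\<in>{2..q}. l dvd q}. \<Pi>\<^sub>E i\<in>I. near_numerators (if i \<in> {a, b} then l else 1) q \<delta>)"

lemma coprime_nearD:
  assumes y: "y \<in> coprime_near a b I q \<delta>" and q: "q > 0" and ab: "a \<in> I" "b \<in> I"
  shows "\<And>i. i \<in> I \<Longrightarrow> y i \<in> near_numerators 1 q \<delta>"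
    and "gcd (gcd \<lfloor>real q * y a\<rfloor> \<lfloor>real q * y b\<rfloor>) (int q) = 1"
proof -
  show near: "y i \<in> near_numerators 1 q \<delta>" if "i \<in> I" for i
    using y that by (auto simp: coprime_near_def)
  define l where "l = nat (gcd (gcd \<lfloor>real q * y a\<rfloor> \<lfloor>real q * y b\<rfloor>) (int q))"
  have int_l: "int l = gcd (gcd \<lfloor>real q * y a\<rfloor> \<lfloor>real q * y b\<rfloor>) (int q)" by (simp add: l_def)
  have d: "int l dvd \<lfloor>real q * y a\<rfloor>" "int l dvd \<lfloor>real q * y b\<rfloor>" "int l dvd int q"
    unfolding int_l by (auto intro: dvd_trans[OF gcd_dvd1])
  then have dq: "l dvd q" by simp
  then have "l > 0" "l \<le> q" using q by (auto intro: dvd_imp_le dvd_pos_nat)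
  moreover have "\<not> 2 \<le> l"
  proof
    assume "2 \<le> l"
    have "y \<in> (\<Pi>\<^sub>E i\<in>I. near_numerators (if i \<in> {a, b} then l else 1) q \<delta>)"
      using y near d by (auto simp: coprime_near_def near_numerators_def PiE_iff)
    with \<open>2 \<le> l\<close> \<open>l \<le> q\<close> dq y show False by (auto simp: coprime_near_def)
  qed
  ultimately have "l = 1" by linarith
  with int_l show "gcd (gcd \<lfloor>real q * y a\<rfloor> \<lfloor>real q * y b\<rfloor>) (int q) = 1" by simp
qed

section \<open>Measure and overlap of the coprime neighbourhoods\<close>

lemma emeasure_PiE_lborel:
  fixes I :: "'i set"
  assumes "finite I" "\<And>i. i \<in> I \<Longrightarrow> X i \<in> sets lborel"
  shows "emeasure (\<Pi>\<^sub>M i\<in>I. lborel) (Pi\<^sub>E I X) = (\<Prod>i\<in>I. emeasure (lborel :: real measure) (X i))"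
proof -
  interpret product_sigma_finite "\<lambda>_::'i. lborel :: real measure" by standard
  show ?thesis using assms by (rule emeasure_PiM)
qed

lemma sets_coprime_near:
  assumes "finite I" "q > 0" "0 \<le> \<delta>" "\<delta> \<le> 1"
  shows "coprime_near a b I q \<delta> \<in> sets (\<Pi>\<^sub>M i\<in>I. lborel)"
  unfolding coprime_near_def
  using assms by (intro sets.Diff sets.finite_UN sets_PiM_I_finite) (auto simp: sets_near_numerators)

text \<open>Asking two numerators to be divisible by \<open>l\<close> keeps the proportion
  \<open>1 / l\<^sup>2\<close> of the full product. Summed over the divisors
  \<open>l \<ge> 2\<close> of \<open>q\<close>, at most \<open>3 / 4\<close> is removed.\<close>

lemma measure_coprime_near_ge:
  assumes I: "finite I" "a \<in> I" "b \<in> I" "a \<noteq> b" and q: "q > 0" and \<delta>: "0 \<le> \<delta>" "\<delta> \<le> 1"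
  shows "\<delta> ^ card I / 4 \<le> measure (\<Pi>\<^sub>M i\<in>I. lborel) (coprime_near a b I q \<delta>)"
proof -
  let ?L = "\<Pi>\<^sub>M i\<in>I. (lborel :: real measure)"
  define V where "V = (I \<rightarrow>\<^sub>E near_numerators 1 q \<delta>)"
  define Z where "Z l = (\<Pi>\<^sub>E i\<in>I. near_numerators (if i \<in> {a, b} then l else 1) q \<delta>)" for l
  define T where "T = {l\<in>{2..q}. l dvd q}"
  have finT: "finite T" by (simp add: T_def)
  have Vs: "V \<in> sets ?L" unfolding V_def
    using I q \<delta> by (intro sets_PiM_I_finite) (auto simp: sets_near_numerators)
  have Zs: "Z l \<in> sets ?L" if "l \<in> T" for l unfolding Z_def
    using I q \<delta> that by (intro sets_PiM_I_finite) (auto simp: T_def sets_near_numerators)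
  have V: "emeasure ?L V = ennreal (\<delta> ^ card I)"
    using I q \<delta> unfolding V_def
    by (subst emeasure_PiE_lborel) (auto simp: sets_near_numerators emeasure_near_numerators ennreal_power)
  have Z: "emeasure ?L (Z l) = ennreal (\<delta> ^ card I * (1 / (real l)\<^sup>2))" if "l \<in> T" for l
  proof -
    have dvd: "(if i \<in> {a, b} then l else 1) dvd q" for i using that by (auto simp: T_def)
    have "emeasure ?L (Z l) = (\<Prod>i\<in>I. ennreal (\<delta> / real (if i \<in> {a, b} then l else 1)))"
      unfolding Z_def using I(1)
      by (simp only: emeasure_PiE_lborel sets_lborel sets_near_numerators[OF q \<delta> dvd] emeasure_near_numerators[OF q \<delta> dvd])
    also have "\<dots> = ennreal (\<Prod>i\<in>I. \<delta> / real (if i \<in> {a, b} then l else 1))"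
      using \<delta> by (intro prod_ennreal) auto
    also have "(\<Prod>i\<in>I. \<delta> / real (if i \<in> {a, b} then l else 1)) = \<delta> ^ card I / (\<Prod>i\<in>I. real (if i \<in> {a, b} then l else 1))"
      by (simp add: prod_dividef)
    also have "(\<Prod>i\<in>I. real (if i \<in> {a, b} then l else 1)) = (\<Prod>i\<in>{a, b}. real l)"
      using I by (intro prod.mono_neutral_cong_right) auto
    finally show ?thesis using I by (simp add: power2_eq_square)
  qed
  have Vf: "V \<in> fmeasurable ?L" using Vs V by (intro fmeasurableI) auto
  have Zf: "Z l \<in> fmeasurable ?L" if "l \<in> T" for l using Zs Z that by (intro fmeasurableI) auto
  have UZ: "(\<Union>l\<in>T. Z l) \<in> fmeasurable ?L" using finT Zf by (intro fmeasurable.finite_UN) auto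
  have "measure ?L (\<Union>l\<in>T. Z l) \<le> (\<Sum>l\<in>T. measure ?L (Z l))"
    using finT Zs by (intro measure_UNION_le) auto
  also have "\<dots> = \<delta> ^ card I * (\<Sum>l\<in>T. 1 / (real l)\<^sup>2)"
    using Z \<delta> by (simp add: measure_def sum_distrib_left)
  also have "\<dots> \<le> \<delta> ^ card I * (3 / 4)"
  proof -
    have "(\<Sum>l\<in>T. 1 / (real l)\<^sup>2) \<le> (\<Sum>l=2..q. 1 / (real l)\<^sup>2)"
      by (intro sum_mono2) (auto simp: T_def)
    then show ?thesis using sum_inverse_squares_le[of q] \<delta> by (intro mult_left_mono) auto
  qed
  finally have 1: "measure ?L (\<Union>l\<in>T. Z l) \<le> \<delta> ^ card I * (3 / 4)" .
  have cn: "coprime_near a b I q \<delta> = V - (\<Union>l\<in>T. Z l)"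
    by (simp add: coprime_near_def V_def Z_def T_def)
  have "measure ?L V \<le> measure ?L ((V - (\<Union>l\<in>T. Z l)) \<union> (\<Union>l\<in>T. Z l))"
    using Vf UZ by (intro measure_mono_fmeasurable fmeasurable.Un fmeasurable.Diff) auto
  also have "\<dots> \<le> measure ?L (V - (\<Union>l\<in>T. Z l)) + measure ?L (\<Union>l\<in>T. Z l)"
    using Vf UZ by (intro measure_Un_le) auto
  finally show ?thesis using 1 V \<delta> by (simp add: cn measure_def)
qed

text \<open>Uniqueness of the reduced denominator of a rational point: \<open>q\<close> divides
  \<open>p\<^sub>1 * r\<close>, \<open>p\<^sub>2 * r\<close> and \<open>q * r\<close>, hence their
  gcd, which is \<open>r\<close>; then by symmetry.\<close>

lemma eq_of_coprime_fractions_eq: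
  fixes q r :: nat and p\<^sub>1 p\<^sub>2 s\<^sub>1 s\<^sub>2 :: int
  assumes "gcd (gcd p\<^sub>1 p\<^sub>2) (int q) = 1" "gcd (gcd s\<^sub>1 s\<^sub>2) (int r) = 1"
    and eq: "p\<^sub>1 * int r = s\<^sub>1 * int q" "p\<^sub>2 * int r = s\<^sub>2 * int q"
  shows "q = r"
proof -
  have "int q dvd int r" if "gcd (gcd p\<^sub>1 p\<^sub>2) (int q) = 1" "p\<^sub>1 * int r = s\<^sub>1 * int q" "p\<^sub>2 * int r = s\<^sub>2 * int q"
    for p\<^sub>1 p\<^sub>2 s\<^sub>1 s\<^sub>2 and q r :: nat
  proof -
    have "int q dvd gcd (gcd (p\<^sub>1 * int r) (p\<^sub>2 * int r)) (int q * int r)"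
      using that by simp
    also have "gcd (p\<^sub>1 * int r) (p\<^sub>2 * int r) = gcd p\<^sub>1 p\<^sub>2 * int r"
      by (simp add: gcd_mult_right abs_mult gcd.commute)
    also have "gcd (gcd p\<^sub>1 p\<^sub>2 * int r) (int q * int r) = gcd (gcd p\<^sub>1 p\<^sub>2) (int q) * int r"
      by (simp add: gcd_mult_right abs_mult gcd.commute)
    also have "\<dots> = int r" by (simp only: that(1) mult_1)
    finally show ?thesis .
  qed
  from this[OF assms(1) eq] this[OF assms(2) eq[symmetric]] show ?thesis
    by (auto intro: dvd_antisym)
qed

text \<open>One common point suffices: in some coordinate its two fractions differ, so
  \<open>p * r - p' * q\<close> is a nonzero multiple of the gcd, yet smaller than the maximum
  \<open>X\<close>. The resulting \<open>gcd q r \<le> X\<close> does not depend on the coordinate,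
  so the one-dimensional overlap bound holds in all of them.\<close>

lemma measure_coprime_near_Int_le:
  assumes I: "finite I" "a \<in> I" "b \<in> I" and qr: "q > 0" "r > 0" "q \<noteq> r"
    and \<delta>: "0 \<le> \<delta>" "\<delta> \<le> 1" and \<epsilon>: "0 \<le> \<epsilon>" "\<epsilon> \<le> 1"
  shows "measure (\<Pi>\<^sub>M i\<in>I. lborel) (coprime_near a b I q \<delta> \<inter> coprime_near a b I r \<epsilon>) \<le> (3 * \<delta> * \<epsilon>) ^ card I"
proof (cases "coprime_near a b I q \<delta> \<inter> coprime_near a b I r \<epsilon> = {}")
  case True
  then show ?thesis using \<delta> \<epsilon> by simp
next
  case False
  let ?L = "\<Pi>\<^sub>M i\<in>I. (lborel :: real measure)"
  from False obtain y where y: "y \<in> coprime_near a b I q \<delta>" "y \<in> coprime_near a b I r \<epsilon>" by blast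
  note D = coprime_nearD[OF y(1) qr(1) I(2,3)] coprime_nearD[OF y(2) qr(2) I(2,3)]
  obtain i where i: "i \<in> I" "\<lfloor>real q * y i\<rfloor> * int r - \<lfloor>real r * y i\<rfloor> * int q \<noteq> 0"
    using eq_of_coprime_fractions_eq[OF D(2,4)] qr(3) I by auto
  have "gcd (int q) (int r) dvd \<lfloor>real q * y i\<rfloor> * int r - \<lfloor>real r * y i\<rfloor> * int q" by simp
  then have "int (gcd q r) \<le> \<bar>\<lfloor>real q * y i\<rfloor> * int r - \<lfloor>real r * y i\<rfloor> * int q\<bar>"
    using i(2) by (metis dvd_imp_le_int gcd_int_int_eq of_nat_0_le_iff abs_of_nonneg)
  then have "real (gcd q r) \<le> \<bar>real_of_int (\<lfloor>real q * y i\<rfloor> * int r - \<lfloor>real r * y i\<rfloor> * int q)\<bar>"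
    by linarith
  also have "\<dots> < max (\<delta> * real r) (\<epsilon> * real q)"
    using D(1,3)[OF i(1)] qr by (intro close_fractions) (auto simp: near_numerators_def)
  finally have X: "real (gcd q r) \<le> max (\<delta> * real r) (\<epsilon> * real q)" by simp
  let ?V = "I \<rightarrow>\<^sub>E (near_numerators 1 q \<delta> \<inter> near_numerators 1 r \<epsilon>)"
  have ns: "near_numerators 1 q \<delta> \<inter> near_numerators 1 r \<epsilon> \<in> sets lborel"
    using qr \<delta> \<epsilon> by (simp add: sets.Int sets_near_numerators)
  have "emeasure ?L (coprime_near a b I q \<delta> \<inter> coprime_near a b I r \<epsilon>) \<le> emeasure ?L ?V"
    using I ns by (intro emeasure_mono sets_PiM_I_finite) (auto simp: coprime_near_def PiE_iff)
  also have "\<dots> = (\<Prod>i\<in>I. emeasure lborel (near_numerators 1 q \<delta> \<inter> near_numerators 1 r \<epsilon>))"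
    using I ns by (intro emeasure_PiE_lborel) auto
  also have "\<dots> \<le> ennreal ((3 * \<delta> * \<epsilon>) ^ card I)"
  proof -
    have "\<exists>m. 0 \<le> m \<and> emeasure lborel (near_numerators 1 q \<delta> \<inter> near_numerators 1 r \<epsilon>) = ennreal m \<and> m \<le> 3 * \<delta> * \<epsilon>"
      using emeasure_near_numerators_Int[OF qr(1,2) \<delta> \<epsilon> X] \<delta> \<epsilon> by (subst (asm) le_ennreal_iff) auto
    then show ?thesis by (auto simp: ennreal_power intro!: ennreal_leI power_mono)
  qed
  finally show ?thesis
    using \<delta> \<epsilon> by (simp add: measure_def enn2real_leI)
qed

text \<open>In dimension at least two the coprimality condition costs only a constant factor, since
  \<open>\<Sum>l\<ge>2. 1 / l\<^sup>2 < 1\<close>; this is why \<open>\<Psi>\<close> need not be monotone.\<close>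

theorem Gallagher:
  fixes I :: "'i set" and \<Psi> :: "nat \<Rightarrow> real"
  assumes I: "finite I" "card I \<ge> 2" and \<Psi>: "\<And>q. 0 \<le> \<Psi> q" "\<And>q. \<Psi> q \<le> 1"
    and div: "\<not> summable (\<lambda>q. \<Psi> q ^ card I)"
  shows "AE y in (\<Pi>\<^sub>M i\<in>I. lborel).
    \<exists>k::nat. \<exists>\<^sub>\<infinity>q. \<forall>i\<in>I. \<exists>p::int. \<bar>real q * y i - of_int p\<bar> < real k * \<Psi> q"
proof -
  let ?L = "\<Pi>\<^sub>M i\<in>I. (lborel :: real measure)"
  obtain a b where ab: "a \<in> I" "b \<in> I" "a \<noteq> b"
    using card_le_Suc0_iff_eq[OF I(1)] I(2) by auto
  define near where "near k q y \<longleftrightarrow> (\<forall>i\<in>I. \<exists>p::int. \<bar>real q * y i - of_int p\<bar> < real k * \<Psi> q)"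
    for k q and y :: "'i \<Rightarrow> real"
  \<comment> \<open>The union over \<open>k\<close> is what makes \<open>A\<close> closed under
    doubling, which replaces \<open>k\<close> by \<open>2 * k\<close>.\<close>
  define A where "A = {y \<in> space ?L. \<exists>k. \<exists>\<^sub>\<infinity>q. near k q y}"
  define E where "E q = (if q = 0 then {} else coprime_near a b I q (\<Psi> q))" for q
  have nearI: "near k q z" if "near j r y" and
    "\<And>i p. i \<in> I \<Longrightarrow> \<bar>real r * y i - of_int p\<bar> < real j * \<Psi> r \<Longrightarrow> \<exists>p::int. \<bar>real q * z i - of_int p\<bar> < real k * \<Psi> q"
    for k q z j r y
    using that unfolding near_def by metis
  have A_sets: "A \<in> sets ?L"
    unfolding A_def INFM_nat near_def using I(1) by measurable
  have "AE y in ?L. y \<in> A"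
  proof (rule AE_of_doubling_invariant[OF I(1) A_sets])
    fix y and c :: "'i \<Rightarrow> int" assume "y \<in> A"
    then obtain k where k: "\<exists>\<^sub>\<infinity>q. near k q y" by (auto simp: A_def)
    have "near k q (\<lambda>i\<in>I. y i + of_int (c i))" if "near k q y" for q
    proof (rule nearI[OF that])
      fix i and p :: int assume "i \<in> I" "\<bar>real q * y i - of_int p\<bar> < real k * \<Psi> q"
      then show "\<exists>p::int. \<bar>real q * (\<lambda>i\<in>I. y i + of_int (c i)) i - of_int p\<bar> < real k * \<Psi> q"
        by (intro exI[of _ "p + int q * c i"]) (simp add: algebra_simps)
    qed
    with k have "\<exists>\<^sub>\<infinity>q. near k q (\<lambda>i\<in>I. y i + of_int (c i))" by (auto elim: INFM_mono)
    then show "(\<lambda>i\<in>I. y i + of_int (c i)) \<in> A" by (auto simp: A_def space_PiM)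
  next
    fix y assume "y \<in> A"
    then obtain k where k: "\<exists>\<^sub>\<infinity>q. near k q y" by (auto simp: A_def)
    have "near (2 * k) q (\<lambda>i\<in>I. 2 * y i)" if "near k q y" for q
    proof (rule nearI[OF that])
      fix i and p :: int assume "i \<in> I" "\<bar>real q * y i - of_int p\<bar> < real k * \<Psi> q"
      then show "\<exists>p::int. \<bar>real q * (\<lambda>i\<in>I. 2 * y i) i - of_int p\<bar> < real (2 * k) * \<Psi> q"
        by (intro exI[of _ "2 * p"]) (simp add: algebra_simps abs_less_iff)
    qed
    with k have "\<exists>\<^sub>\<infinity>q. near (2 * k) q (\<lambda>i\<in>I. 2 * y i)" by (auto elim: INFM_mono)
    then show "(\<lambda>i\<in>I. 2 * y i) \<in> A" by (auto simp: A_def space_PiM)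
  next
    have Es: "E q \<in> sets ?L" for q
      using I \<Psi> by (simp add: E_def sets_coprime_near)
    have EU: "E q \<subseteq> I \<rightarrow>\<^sub>E {0..<1}" for q
      by (auto simp: E_def coprime_near_def near_numerators_def PiE_iff)
    have U: "I \<rightarrow>\<^sub>E {0..<1::real} \<in> fmeasurable ?L"
      using I by (intro fmeasurableI) (auto simp: emeasure_PiE_lborel)
    have lower: "\<Psi> q ^ card I / 4 \<le> measure ?L (E q)" if "q > 0" for q
      using measure_coprime_near_ge[OF I(1) ab that \<Psi>] that by (simp add: E_def)
    have "0 < emeasure ?L (\<Inter>N. \<Union>q\<in>{N..}. E q)"
    proof (rule emeasure_limsup_pos_of_quasi_independent[OF U Es EU])
      \<comment> \<open>The factor \<open>3 ^ card I\<close> comes from the overlap bound, and 16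
        from the two lower bounds by \<open>\<Psi> ^ card I / 4\<close>.\<close>
      show "0 \<le> 16 * (3::real) ^ card I" by simp
      show "measure ?L (E q \<inter> E r) \<le> 16 * 3 ^ card I * measure ?L (E q) * measure ?L (E r)"
        if "q \<noteq> r" for q r
      proof (cases "q = 0 \<or> r = 0")
        case True
        then show ?thesis by (auto simp: E_def)
      next
        case False
        then have "measure ?L (E q \<inter> E r) \<le> (3 * \<Psi> q * \<Psi> r) ^ card I"
          using measure_coprime_near_Int_le[OF I(1) ab(1,2) _ _ that \<Psi> \<Psi>] by (simp add: E_def)
        also have "\<dots> = 16 * 3 ^ card I * ((\<Psi> q ^ card I / 4) * (\<Psi> r ^ card I / 4))"
          by (simp add: power_mult_distrib)
        also have "\<dots> \<le> 16 * 3 ^ card I * (measure ?L (E q) * measure ?L (E r))"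
          using False lower[of q] lower[of r] \<Psi> by (intro mult_left_mono mult_mono) auto
        finally show ?thesis by (simp add: mult.assoc)
      qed
      show "\<not> summable (\<lambda>q. measure ?L (E q))"
      proof
        assume "summable (\<lambda>q. measure ?L (E q))"
        then have "summable (\<lambda>q. 4 * measure ?L (E q))" by (rule summable_mult)
        moreover have "eventually (\<lambda>q. norm (\<Psi> q ^ card I) \<le> 4 * measure ?L (E q)) sequentially"
          using eventually_gt_at_top[of 0]
        proof eventually_elim
          case (elim q)
          then show ?case using lower[OF elim] \<Psi>(1)[of q] by simp
        qed
        ultimately have "summable (\<lambda>q. \<Psi> q ^ card I)"
          by (rule summable_comparison_test_ev[rotated])
        with div show False by contradiction
      qed
    qed
    moreover have "(\<Inter>N. \<Union>q\<in>{N..}. E q) \<subseteq> A \<inter> (I \<rightarrow>\<^sub>E {0..<1})"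
    proof
      fix y assume y: "y \<in> (\<Inter>N. \<Union>q\<in>{N..}. E q)"
      have "near 1 q y" if "y \<in> E q" for q
        unfolding near_def
      proof
        fix i assume "i \<in> I"
        with that have "frac (real q * y i) < \<Psi> q"
          by (auto simp: E_def coprime_near_def near_numerators_def PiE_iff split: if_splits)
        then show "\<exists>p::int. \<bar>real q * y i - of_int p\<bar> < real 1 * \<Psi> q"
          using frac_ge_0[of "real q * y i"]
          by (intro exI[of _ "\<lfloor>real q * y i\<rfloor>"]) (simp add: frac_def)
      qed
      moreover have "\<exists>\<^sub>\<infinity>q. y \<in> E q"
        using y by (auto simp: INFM_nat_le)
      ultimately have "\<exists>\<^sub>\<infinity>q. near 1 q y" by (auto elim: INFM_mono)
      moreover have "y \<in> I \<rightarrow>\<^sub>E {0..<1}" using y EU by blast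
      ultimately show "y \<in> A \<inter> (I \<rightarrow>\<^sub>E {0..<1})" by (auto simp: A_def space_PiM)
    qed
    ultimately show "0 < emeasure ?L (A \<inter> (I \<rightarrow>\<^sub>E {0..<1}))"
      using A_sets fmeasurableD[OF U] by (meson emeasure_mono less_le_trans sets.Int)
  qed
  then show ?thesis by eventually_elim (auto simp: A_def near_def)
qed

section \<open>The fiber over \<open>x\<close>\<close>

text \<open>\<open>W\<close> counts pairs; choosing one numerator vector for each good
  \<open>q \<ge> 1\<close> gives pairs that are distinct in their second component.\<close>

lemma mem_W_of_infinitely_often:
  assumes d: "d \<ge> 1" and y: "y \<in> {1..d} \<rightarrow>\<^sub>E UNIV"
    and inf: "\<exists>\<^sub>\<infinity>q. \<forall>i\<in>{1..d}. \<exists>p::int. \<bar>real q * y i - of_int p\<bar> < \<phi> q"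
  shows "y \<in> W d \<phi>"
proof -
  define T where "T = {q. q \<ge> 1 \<and> (\<forall>i\<in>{1..d}. \<exists>p::int. \<bar>real q * y i - of_int p\<bar> < \<phi> q)}"
  have "\<exists>\<^sub>\<infinity>q. q \<in> T"
    using INFM_conjI[OF inf, of "\<lambda>q. 1 \<le> q"] eventually_ge_at_top[of 1]
    by (auto simp: T_def MOST_iff_cofinite cofinite_eq_sequentially conj_commute)
  then have infT: "infinite T" by (simp add: INFM_iff_infinite)
  define P where "P q = (\<lambda>i\<in>{1..d}. SOME p::int. \<bar>real q * y i - of_int p\<bar> < \<phi> q)" for q
  have P: "\<bar>real q * y i - of_int (P q i)\<bar> < \<phi> q" if "q \<in> T" "i \<in> {1..d}" for q i
  proof -
    have "\<exists>p::int. \<bar>real q * y i - of_int p\<bar> < \<phi> q" using that by (auto simp: T_def)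
    from someI_ex[OF this] show ?thesis using that by (simp add: P_def)
  qed
  let ?S = "{(p, q). p \<in> {1..d} \<rightarrow>\<^sub>E (UNIV :: int set) \<and> q \<ge> 1 \<and>
       sup_norm d (\<lambda>i. real q * y i - of_int (p i)) < \<phi> q}"
  have "(\<lambda>q. (P q, q)) ` T \<subseteq> ?S"
  proof (rule image_subsetI)
    fix q assume q: "q \<in> T"
    have "P q \<in> {1..d} \<rightarrow>\<^sub>E UNIV" by (simp add: P_def)
    moreover have "1 \<le> q" using q by (simp add: T_def)
    moreover have "sup_norm d (\<lambda>i. real q * y i - of_int (P q i)) < \<phi> q"
      unfolding sup_norm_def using d P[OF q] by (subst Max_less_iff) auto
    ultimately show "(P q, q) \<in> ?S" by blast
  qed
  moreover have "infinite ((\<lambda>q. (P q, q)) ` T)"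
    using infT by (subst finite_image_iff) (auto simp: inj_on_def)
  ultimately have "infinite ?S" by (rule infinite_super)
  with y show ?thesis by (simp add: W_def)
qed

lemma \<psi>_nonneg: "\<psi> s d q \<ge> 0"
  by (simp add: \<psi>_def)

text \<open>Passing from \<open>s\<close> to \<open>Suc s\<close> keeps the series divergent and gains a factor that
  tends to infinity, which absorbs the unspecified constant \<open>k\<close> of \<open>Gallagher\<close>.\<close>

theorem theorem30:
  fixes d s :: nat and x :: real
  assumes "d \<ge> 3" and "s \<ge> 1"
    and "x \<notin> \<rat>" and "\<not> Liouville x"
    and "condition_a s x \<or> condition_b x"
  shows "AE y in (\<Pi>\<^sub>M i\<in>{2..d}. lborel). y(1 := x) \<in> W d (\<psi> s d)"
proof -
  let ?near = "\<lambda>q. \<exists>p::int. \<bar>real q * x - of_int p\<bar> < \<psi> (Suc s) d q"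
  \<comment> \<open>The value 0 encodes unavailability of \<open>q\<close> in the first coordinate,
    and the minimum supplies the bound by 1 at every \<open>q\<close>; it is eventually
    inactive.\<close>
  define \<Psi> where "\<Psi> q = (if ?near q then min 1 (\<psi> (Suc s) d q) else 0)" for q
  have \<psi>_le_1: "\<forall>\<^sub>F q in sequentially. \<psi> (Suc s) d q \<le> 1"
    using eventually_iter_ln_ge[of "Suc s" 1]
  proof eventually_elim
    case (elim q)
    then have L1: "iter_ln j (real q) \<ge> 1" if "j \<le> Suc s" for j using that by blast
    define P where "P = (\<Prod>j\<le>Suc s. iter_ln j (real q))"
    have "1 \<le> P" unfolding P_def by (intro prod_ge_1) (auto intro: L1 simp del: funpow.simps)
    then have "P powr (- 1 / real d) \<le> P powr 0" by (intro powr_mono) auto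
    also have "\<dots> = 1" using \<open>1 \<le> P\<close> by simp
    finally show ?case using \<psi>_eq[OF L1] by (simp add: P_def)
  qed
  have "\<not> summable (\<lambda>q. \<Psi> q ^ card {2..d})"
  proof -
    have "\<forall>\<^sub>F q in sequentially. \<Psi> q ^ card {2..d} = (if ?near q then \<psi> (Suc s) d q ^ (d - 1) else 0)"
      using \<psi>_le_1
    proof eventually_elim
      case (elim q)
      then show ?case using assms(1) by (auto simp: \<Psi>_def min_absorb2)
    qed
    then show ?thesis
      using not_summable_\<psi>_near_integers[of d x "Suc s"] assms(1) by (subst summable_cong) auto
  qed
  then have "AE y in (\<Pi>\<^sub>M i\<in>{2..d}. lborel). \<exists>k::nat. \<exists>\<^sub>\<infinity>q.
      \<forall>i\<in>{2..d}. \<exists>p::int. \<bar>real q * y i - of_int p\<bar> < real k * \<Psi> q"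
    using assms(1) by (intro Gallagher) (auto simp: \<Psi>_def \<psi>_nonneg)
  moreover have "AE y in (\<Pi>\<^sub>M i\<in>{2..d}. lborel). y \<in> {2..d} \<rightarrow>\<^sub>E (UNIV :: real set)"
    using AE_space by eventually_elim (simp add: space_PiM)
  ultimately show ?thesis
  proof eventually_elim
    case (elim y)
    then obtain k :: nat where
      k: "\<exists>\<^sub>\<infinity>q. \<forall>i\<in>{2..d}. \<exists>p::int. \<bar>real q * y i - of_int p\<bar> < real k * \<Psi> q" by blast
    show ?case
    proof (rule mem_W_of_infinitely_often)
      show "1 \<le> d" using assms(1) by simp
      show "y(1 := x) \<in> {1..d} \<rightarrow>\<^sub>E UNIV"
        using elim(2) assms(1) by (auto simp: PiE_iff extensional_def)
      have "\<forall>\<^sub>F q in sequentially. real k * \<psi> (Suc s) d q \<le> \<psi> s d q \<and> 1 * \<psi> (Suc s) d q \<le> \<psi> s d q"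
        using assms(1) by (intro eventually_conj eventually_times_\<psi>_Suc_le) auto
      then have "\<forall>\<^sub>\<infinity>q. real k * \<psi> (Suc s) d q \<le> \<psi> s d q \<and> \<psi> (Suc s) d q \<le> \<psi> s d q"
        by (simp add: cofinite_eq_sequentially)
      from INFM_conjI[OF k this]
      show "\<exists>\<^sub>\<infinity>q. \<forall>i\<in>{1..d}. \<exists>p::int. \<bar>real q * (y(1 := x)) i - of_int p\<bar> < \<psi> s d q"
      proof (rule INFM_mono)
        fix q
        assume *: "(\<forall>i\<in>{2..d}. \<exists>p::int. \<bar>real q * y i - of_int p\<bar> < real k * \<Psi> q) \<and>
          real k * \<psi> (Suc s) d q \<le> \<psi> s d q \<and> \<psi> (Suc s) d q \<le> \<psi> s d q"
        have "2 \<in> {2..d}" using assms(1) by simp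
        \<comment> \<open>A strict inequality with right side 0 is impossible, so being a solution
          in coordinate 2 already forces the first coordinate to be close to an integer.\<close>
        with * have "\<Psi> q \<noteq> 0" by fastforce
        then have near: "?near q" by (rule contrapos_np) (simp add: \<Psi>_def)
        then have "real k * \<Psi> q \<le> real k * \<psi> (Suc s) d q"
          by (intro mult_left_mono) (auto simp: \<Psi>_def)
        with * have le: "real k * \<Psi> q \<le> \<psi> s d q" by linarith
        show "\<forall>i\<in>{1..d}. \<exists>p::int. \<bar>real q * (y(1 := x)) i - of_int p\<bar> < \<psi> s d q"
        proof
          fix i assume i: "i \<in> {1..d}"
          show "\<exists>p::int. \<bar>real q * (y(1 := x)) i - of_int p\<bar> < \<psi> s d q"
          proof (cases "i = 1")
            case True
            from near obtain p :: int where "\<bar>real q * x - of_int p\<bar> < \<psi> (Suc s) d q" by blast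
            with * have "\<bar>real q * x - of_int p\<bar> < \<psi> s d q" by linarith
            with True show ?thesis by auto
          next
            case False
            with i have "i \<in> {2..d}" by auto
            with * obtain p :: int where "\<bar>real q * y i - of_int p\<bar> < real k * \<Psi> q" by blast
            with le have "\<bar>real q * y i - of_int p\<bar> < \<psi> s d q" by linarith
            with False show ?thesis by auto
          qed
        qed
      qed
    qed
  qed
qed

end
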